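(* For any $k,p\in\mathbb{N}=\{1,2,\ldots\}$, $$F_k(t_1,t_2,\ldots,t_p)=P_k(1,t_1,\ldots,t_p)$$ as polynomials in the variables $t_1,\ldots,t_p$.
   Context: The multivariate Fuss-Narayana polynomials are $$F_k(t_1,\ldots,t_p)=\sum_{\substack{j_0,\ldots,j_p\in\{1,\ldots,k\}\\ j_0+\cdots+j_p=pk+1}}\frac{1}{k}\binom{k}{j_0}\binom{k}{j_1}\cdots\binom{k}{j_p}\,t_1^{j_1}t_2^{j_2}\cdots t_p^{j_p}.$$ A noncrossing pair partition of $[m]=\{1,\ldots,m\}$ ($m$ even) is a partition of $[m]$ into two-element blocks such that there are no two blocks $\{a,b\}$ and $\{c,e\}$ with $a<c<b<e$. For a block $\{a,b\}$ with $a<b$, $b$ is called its right leg. The set of these partitions is $\mathcal{NC}^2_m$. Consider the letters $1,\ldots,p,1^*,\ldots,p^*$. Let $W_0=1\,2\cdots p\,p^*\cdots 2^*1^*$ (a word of length $2p$), and let $W_0^k$ be its $k$-fold concatenation (of length $2pk$). A partition $\pi\in\mathcal{NC}^2_{2pk}$ is adapted to $W_0^k$ if, for each block $\{a,b\}$ of $\pi$, the letters at positions $a$ and $b$ of $W_0^k$ are $l$ and $l^*$ in some order, for some $l\in\{1,\ldots,p\}$. The set of such partitions is $\mathcal{NC}^2_{2pk}(W_0^k)$. For $\pi\in\mathcal{NC}^2_{2pk}(W_0^k)$ let $\mathcal{R}_l(\pi)$ (resp. $\mathcal{R}_l^*(\pi)$) be the set of right legs of $\pi$ whose letter in $W_0^k$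 is $l$ (resp. $l^*$), with $\mathcal{R}_0^*(\pi)=\emptyset$ and $\mathcal{R}_{p+1}(\pi)=\emptyset$. For $0\leq l\leq p$ put $j_l(\pi)=|\mathcal{R}_{l+1}(\pi)|+|\mathcal{R}_l^*(\pi)|$. Define $$P_k(d_0,\ldots,d_p)=\sum_{\pi\in\mathcal{NC}^2_{2pk}(W_0^k)}d_0^{j_0(\pi)}d_1^{j_1(\pi)}\cdots d_p^{j_p(\pi)}.$$ *)

theory Defs
  imports Complex_Main "HOL-Library.FuncSet" "HOL-Library.Disjoint_Sets" "HOL-Library.Poly_Mapping"
begin

section \<open>Polynomials with rational coefficients\<close>

text \<open>
  A monomial is a finitely supported exponent function on the variable indices; a polynomial is
  a finitely supported function from monomials to coefficients, with the convolution product.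
\<close>

type_synonym rat_mpoly = "(nat \<Rightarrow>\<^sub>0 nat) \<Rightarrow>\<^sub>0 rat"

definition Var :: "nat \<Rightarrow> rat_mpoly" where
  "Var i = Poly_Mapping.single (Poly_Mapping.single i 1) 1"

definition Const :: "rat \<Rightarrow> rat_mpoly" where
  "Const c = Poly_Mapping.single 0 c"


section \<open>Multivariate Fuss-Narayana polynomials\<close>

text \<open>The variable \<open>t\<^sub>l\<close> is \<open>Var l\<close>; \<open>Var 0\<close> does not occur.\<close>

definition fuss_narayana :: "nat \<Rightarrow> nat \<Rightarrow> rat_mpoly" where
  "fuss_narayana k p =
     (\<Sum>j \<in> {j \<in> {0..p} \<rightarrow>\<^sub>E {1..k}. (\<Sum>l=0..p. j l) = p * k + 1}.
        Const (1 / of_nat k * (\<Prod>l=0..p. of_nat (k choose j l))) * (\<Prod>l=1..p. Var l ^ j l))"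


section \<open>Noncrossing pair partitions adapted to a word\<close>

definition nc_pair_partitions :: "nat \<Rightarrow> nat set set set" where
  "nc_pair_partitions m =
     {\<pi>. partition_on {1..m} \<pi> \<and> (\<forall>B\<in>\<pi>. card B = 2) \<and>
         \<not> (\<exists>a b c e. {a, b} \<in> \<pi> \<and> {c, e} \<in> \<pi> \<and> a < c \<and> c < b \<and> b < e)}"

datatype letter = Plain nat | Star nat

definition W0 :: "nat \<Rightarrow> letter list" where
  "W0 p = map Plain [1..<Suc p] @ map Star (rev [1..<Suc p])"

definition W0_power :: "nat \<Rightarrow> nat \<Rightarrow> letter list" where
  "W0_power k p = concat (replicate k (W0 p))"

text \<open>Positions in a word are counted from 1.\<close>

definition letter_at :: "letter list \<Rightarrow> nat \<Rightarrow> letter" where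
  "letter_at w a = w ! (a - 1)"

definition adapted_nc :: "nat \<Rightarrow> nat \<Rightarrow> nat set set set" where
  "adapted_nc k p =
     {\<pi> \<in> nc_pair_partitions (2 * p * k).
        \<forall>a b. {a, b} \<in> \<pi> \<longrightarrow>
          (\<exists>l\<in>{1..p}. {letter_at (W0_power k p) a, letter_at (W0_power k p) b} = {Plain l, Star l})}"

definition right_legs :: "nat set set \<Rightarrow> nat set" where
  "right_legs \<pi> = {b. \<exists>a. a < b \<and> {a, b} \<in> \<pi>}"

definition R_plain :: "nat \<Rightarrow> nat \<Rightarrow> nat \<Rightarrow> nat set set \<Rightarrow> nat set" where
  "R_plain k p l \<pi> = {b \<in> right_legs \<pi>. letter_at (W0_power k p) b = Plain l}"

definition R_star :: "nat \<Rightarrow> nat \<Rightarrow> nat \<Rightarrow> nat set set \<Rightarrow> nat set" where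
  "R_star k p l \<pi> = {b \<in> right_legs \<pi>. letter_at (W0_power k p) b = Star l}"

text \<open>
  The conventions for the boundary indices \<open>0\<close> and \<open>p + 1\<close> need no separate clause: the
  corresponding letters do not occur in the word.
\<close>

lemma R_boundary_empty:
  assumes "\<pi> \<in> adapted_nc k p"
  shows "R_star k p 0 \<pi> = {}" "R_plain k p (Suc p) \<pi> = {}"
proof -
  have *: "\<exists>l\<in>{1..p}. letter_at (W0_power k p) b = Plain l \<or> letter_at (W0_power k p) b = Star l"
    if b: "b \<in> right_legs \<pi>" for b
  proof -
    from b obtain a where "{a, b} \<in> \<pi>"
      unfolding right_legs_def by blast
    with assms obtain l where l: "l \<in> {1..p}"
      and "{letter_at (W0_power k p) a, letter_at (W0_power k p) b} = {Plain l, Star l}"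
      unfolding adapted_nc_def by blast
    then have "letter_at (W0_power k p) b \<in> {Plain l, Star l}"
      by blast
    with l show ?thesis
      by blast
  qed
  show "R_star k p 0 \<pi> = {}"
    using * unfolding R_star_def by fastforce
  show "R_plain k p (Suc p) \<pi> = {}"
    using * unfolding R_plain_def by fastforce
qed

definition leg_count :: "nat \<Rightarrow> nat \<Rightarrow> nat \<Rightarrow> nat set set \<Rightarrow> nat" where
  "leg_count k p l \<pi> = card (R_plain k p (l + 1) \<pi>) + card (R_star k p l \<pi>)"

text \<open>
  The coefficients are natural numbers, so the arguments \<open>d\<^sub>0, \<dots>, d\<^sub>p\<close> may be taken from any
  commutative semiring, in particular from a polynomial ring.
\<close>

definition P_poly :: "nat \<Rightarrow> nat \<Rightarrow> (nat \<Rightarrow> 'a::comm_semiring_1) \<Rightarrow> 'a" where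
  "P_poly k p d = (\<Sum>\<pi>\<in>adapted_nc k p. \<Prod>l=0..p. d l ^ leg_count k p l \<pi>)"

end

theory Submission
  imports Defs "HOL-Computational_Algebra.Formal_Power_Series"
begin

text \<open>
  Reading the word \<open>W\<^sub>0\<^sup>k\<close> letter by letter, with \<open>l\<close> as a step up from height \<open>l - 1\<close> to height \<open>l\<close>
  and \<open>l\<^sup>*\<close> as the step back down, gives a path that zigzags \<open>k\<close> times between the heights \<open>0\<close>
  and \<open>p\<close>. Two letters may be paired exactly if one step undoes the other, and a right leg is
  counted by \<open>j\<^sub>l\<close> exactly if its step starts at height \<open>l\<close>. So \<open>P\<^sub>k\<close> is a weighted count of
  noncrossing arc diagrams over a path, where an arc ending with a step from height \<open>l\<close> has weight
  \<open>t\<^sub>l\<close>.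

  Splitting a diagram at its first arc cuts the path into pieces that again begin and end at a
  common height. Up to translation by periods there are four families of such pieces at each height
  \<open>l\<close>, since each end is passed on the way up or on the way down. Recording in \<open>z\<close> the number of
  periods, their four generating functions satisfy relations that connect height \<open>l\<close> to
  \<open>l + 1\<close> (lemmas \<open>up_eq\<close>, \<open>hill_eq\<close>) and to \<open>l - 1\<close> (lemmas \<open>down_eq\<close>, \<open>valley_eq\<close>). Solving them
  for the series \<open>X\<^sub>l\<close>, which is \<open>t\<^sub>l\<close> times the generating function of one family at height \<open>l\<close>,
  gives the symmetric system
  \<open>X\<^sub>l = t\<^sub>l + Y\<close> with \<open>Y = z X\<^sub>0 \<cdots> X\<^sub>p\<close> (lemma \<open>planted_eq\<close>). Hence
  \<open>Y = z (t\<^sub>0 + Y) \<cdots> (t\<^sub>p + Y)\<close>, while \<open>t\<^sub>0 P\<^sub>k\<close> is the coefficient of \<open>z\<^sup>k\<close> in \<open>X\<^sub>0 = t\<^sub>0 + Y\<close>.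

  Lagrange inversion (lemma \<open>lagrange_inversion\<close>) turns this into
  \<open>k t\<^sub>0 P\<^sub>k = [y\<^sup>k\<^sup>-\<^sup>1] ((t\<^sub>0 + y) \<cdots> (t\<^sub>p + y))\<^sup>k\<close>, and expanding the powers by the binomial theorem gives
  the sum over \<open>j\<^sub>0 + \<dots> + j\<^sub>p = (p + 1) k - (k - 1) = p k + 1\<close> that defines the Fuss-Narayana
  polynomial. Setting \<open>t\<^sub>0 = 1\<close> finishes the proof; the exponents satisfy \<open>j\<^sub>l \<ge> 1\<close> because the
  other \<open>p\<close> of them are at most \<open>k\<close>.
\<close>

unbundle fps_syntax

section \<open>Noncrossing arc diagrams\<close>

text \<open>
  Noncrossing pairings of the positions \<open>a + 1, \<dots>, b\<close>, each block represented by its ordered pair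
  of legs; \<^term>\<open>M x y\<close> says that the left leg \<open>x\<close> may be joined to the right leg \<open>y\<close>. Positions are the steps
  of a path and \<open>a\<close> and \<open>b\<close> are its end points, so that consecutive paths share a point but no
  step.
\<close>
definition arc_diagrams :: "(nat \<Rightarrow> nat \<Rightarrow> bool) \<Rightarrow> nat \<Rightarrow> nat \<Rightarrow> (nat \<times> nat) set set" where
  "arc_diagrams M a b =
     {E. (\<forall>x y. (x, y) \<in> E \<longrightarrow> a < x \<and> x < y \<and> y \<le> b \<and> M x y) \<and>
         (\<forall>z. a < z \<and> z \<le> b \<longrightarrow> (\<exists>x y. (x, y) \<in> E \<and> (z = x \<or> z = y))) \<and>
         (\<forall>x y u v. (x, y) \<in> E \<and> (u, v) \<in> E \<and> {x, y} \<inter> {u, v} \<noteq> {} \<longrightarrow> x = u \<and> y = v) \<and>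
         (\<forall>x y u v. (x, y) \<in> E \<and> (u, v) \<in> E \<longrightarrow> \<not> (x < u \<and> u < y \<and> y < v))}"

lemma arc_diagramsI:
  assumes "\<And>x y. (x, y) \<in> E \<Longrightarrow> a < x \<and> x < y \<and> y \<le> b \<and> M x y"
    and "\<And>z. a < z \<Longrightarrow> z \<le> b \<Longrightarrow> \<exists>x y. (x, y) \<in> E \<and> (z = x \<or> z = y)"
    and "\<And>x y u v. (x, y) \<in> E \<Longrightarrow> (u, v) \<in> E \<Longrightarrow> {x, y} \<inter> {u, v} \<noteq> {} \<Longrightarrow> x = u \<and> y = v"
    and "\<And>x y u v. (x, y) \<in> E \<Longrightarrow> (u, v) \<in> E \<Longrightarrow> x < u \<Longrightarrow> u < y \<Longrightarrow> y < v \<Longrightarrow> False"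
  shows "E \<in> arc_diagrams M a b"
  using assms unfolding arc_diagrams_def mem_Collect_eq by blast

lemma arc_diagramsD:
  assumes "E \<in> arc_diagrams M a b"
  shows "(x, y) \<in> E \<Longrightarrow> a < x \<and> x < y \<and> y \<le> b \<and> M x y"
    and "a < z \<Longrightarrow> z \<le> b \<Longrightarrow> \<exists>x y. (x, y) \<in> E \<and> (z = x \<or> z = y)"
    and "(x, y) \<in> E \<Longrightarrow> (u, v) \<in> E \<Longrightarrow> {x, y} \<inter> {u, v} \<noteq> {} \<Longrightarrow> x = u \<and> y = v"
    and "(x, y) \<in> E \<Longrightarrow> (u, v) \<in> E \<Longrightarrow> x < u \<Longrightarrow> u < y \<Longrightarrow> y < v \<Longrightarrow> False"
  using assms unfolding arc_diagrams_def mem_Collect_eq by blast+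

lemma finite_arc_diagram:
  assumes "E \<in> arc_diagrams M a b"
  shows "finite E"
proof (rule finite_subset)
  show "E \<subseteq> {..b} \<times> {..b}"
    using arc_diagramsD(1)[OF assms] by fastforce
qed simp

lemma finite_arc_diagrams: "finite (arc_diagrams M a b)"
proof (rule finite_subset)
  show "arc_diagrams M a b \<subseteq> Pow ({..b} \<times> {..b})"
    using arc_diagramsD(1) by fastforce
qed simp

lemma arc_diagrams_empty: "arc_diagrams M a b = {{}}" if "b \<le> a"
proof (intro equalityI subsetI)
  fix E assume "E \<in> arc_diagrams M a b"
  from arc_diagramsD(1)[OF this] that have "(x, y) \<notin> E" for x y by fastforce
  then show "E \<in> {{}}" by auto
qed (use that in \<open>auto intro: arc_diagramsI\<close>)

definition add_first_arc :: "nat \<Rightarrow> nat \<times> (nat \<times> nat) set \<times> (nat \<times> nat) set \<Rightarrow> (nat \<times> nat) set" where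
  "add_first_arc a = (\<lambda>(y, E1, E2). insert (Suc a, y) (E1 \<union> E2))"

text \<open>
  By noncrossing, every other arc lies either strictly below the arc that starts at the first
  position or entirely to its right, and the two groups are independent.
\<close>
lemma bij_betw_add_first_arc:
  assumes "a < b"
  shows "bij_betw (add_first_arc a)
           (SIGMA y:{y. Suc a < y \<and> y \<le> b \<and> M (Suc a) y}.
              arc_diagrams M (Suc a) (y - 1) \<times> arc_diagrams M y b)
           (arc_diagrams M a b)" (is "bij_betw _ ?S _")
proof (rule bij_betw_imageI)
  \<comment> \<open>the triple can be read off the positions of the arcs\<close>
  have recover: "{e \<in> add_first_arc a (y, E1, E2). fst e = Suc a} = {(Suc a, y)}"
      "{e \<in> add_first_arc a (y, E1, E2). fst e \<noteq> Suc a \<and> snd e < y} = E1"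
      "{e \<in> add_first_arc a (y, E1, E2). y < fst e} = E2"
    if "(y, E1, E2) \<in> ?S" for y E1 E2
  proof -
    from that have y: "Suc a < y" and E: "E1 \<in> arc_diagrams M (Suc a) (y - 1)" "E2 \<in> arc_diagrams M y b"
      by auto
    note [dest] = arc_diagramsD(1)[OF E(1)] arc_diagramsD(1)[OF E(2)]
    show "{e \<in> add_first_arc a (y, E1, E2). fst e = Suc a} = {(Suc a, y)}"
      using y by (auto simp: add_first_arc_def)
    show "{e \<in> add_first_arc a (y, E1, E2). fst e \<noteq> Suc a \<and> snd e < y} = E1"
      using y by (fastforce simp: add_first_arc_def)
    show "{e \<in> add_first_arc a (y, E1, E2). y < fst e} = E2"
      using y by (fastforce simp: add_first_arc_def)
  qed
  show "inj_on (add_first_arc a) ?S"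
  proof (rule inj_onI)
    fix s s' assume s: "s \<in> ?S" "s' \<in> ?S" and eq: "add_first_arc a s = add_first_arc a s'"
    obtain y E1 E2 where 1: "s = (y, E1, E2)" by (cases s)
    obtain y' E1' E2' where 2: "s' = (y', E1', E2')" by (cases s')
    from recover(1)[OF s(1)[unfolded 1]] recover(1)[OF s(2)[unfolded 2]] eq
    have y: "y = y'" unfolding 1 2 by simp
    have "E1 = E1'" "E2 = E2'"
      using recover(2,3)[OF s(1)[unfolded 1]] recover(2,3)[OF s(2)[unfolded 2]] eq
      unfolding 1 2 y by simp_all
    with y show "s = s'" unfolding 1 2 by simp
  qed
  show "add_first_arc a ` ?S = arc_diagrams M a b"
  proof (intro equalityI subsetI)
    fix E assume "E \<in> add_first_arc a ` ?S"
    then obtain y E1 E2 where E: "E = insert (Suc a, y) (E1 \<union> E2)"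
      and y: "Suc a < y" "y \<le> b" "M (Suc a) y"
      and E1: "E1 \<in> arc_diagrams M (Suc a) (y - 1)" and E2: "E2 \<in> arc_diagrams M y b"
      unfolding add_first_arc_def by auto
    have r1: "Suc a < u \<and> u < v \<and> v < y \<and> M u v" if "(u, v) \<in> E1" for u v
      using arc_diagramsD(1)[OF E1 that] y by auto
    have r2: "y < u \<and> u < v \<and> v \<le> b \<and> M u v" if "(u, v) \<in> E2" for u v
      using arc_diagramsD(1)[OF E2 that] by auto
    have cases: thesis
      if "(u, v) \<in> E" "u = Suc a \<Longrightarrow> v = y \<Longrightarrow> thesis"
        "(u, v) \<in> E1 \<Longrightarrow> Suc a < u \<Longrightarrow> u < v \<Longrightarrow> v < y \<Longrightarrow> M u v \<Longrightarrow> thesis"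
        "(u, v) \<in> E2 \<Longrightarrow> y < u \<Longrightarrow> u < v \<Longrightarrow> v \<le> b \<Longrightarrow> M u v \<Longrightarrow> thesis" for u v thesis
      using that r1 r2 unfolding E by blast
    show "E \<in> arc_diagrams M a b"
    proof (rule arc_diagramsI)
      fix u v assume "(u, v) \<in> E"
      then show "a < u \<and> u < v \<and> v \<le> b \<and> M u v"
        by (rule cases) (use y in auto)
    next
      fix z assume z: "a < z" "z \<le> b"
      then consider "z = Suc a" | "z = y" | "Suc a < z" "z \<le> y - 1" | "y < z"
        by linarith
      then show "\<exists>u v. (u, v) \<in> E \<and> (z = u \<or> z = v)"
      proof cases
        case 3
        from arc_diagramsD(2)[OF E1 this] show ?thesis unfolding E by blast
      next
        case 4
        from arc_diagramsD(2)[OF E2 this z(2)] show ?thesis unfolding E by blast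
      qed (auto simp: E)
    next
      fix u v u' v' assume uv: "(u, v) \<in> E" "(u', v') \<in> E" "{u, v} \<inter> {u', v'} \<noteq> {}"
      from uv(3) have uv3: "u = u' \<or> u = v' \<or> v = u' \<or> v = v'" by auto
      show "u = u' \<and> v = v'"
        using uv(1)
      proof (rule cases)
        assume "u = Suc a" "v = y"
        with uv(2) show ?thesis
          by (elim cases) (use uv3 y in auto)
      next
        assume *: "(u, v) \<in> E1" "Suc a < u" "u < v" "v < y"
        from uv(2) show ?thesis
        proof (rule cases)
          assume "(u', v') \<in> E1"
          with *(1) show ?thesis using arc_diagramsD(3)[OF E1] uv(3) by blast
        qed (use uv3 y * in auto)
      next
        assume *: "(u, v) \<in> E2" "y < u" "u < v"
        from uv(2) show ?thesis
        proof (rule cases)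
          assume "(u', v') \<in> E2"
          with *(1) show ?thesis using arc_diagramsD(3)[OF E2] uv(3) by blast
        qed (use uv3 y * in auto)
      qed
    next
      fix u v u' v' assume uv: "(u, v) \<in> E" "(u', v') \<in> E" "u < u'" "u' < v" "v < v'"
      from uv(1) show False
      proof (rule cases)
        assume "u = Suc a" "v = y"
        with uv(2) show ?thesis
          by (elim cases) (use uv y in auto)
      next
        assume *: "(u, v) \<in> E1" "Suc a < u" "u < v" "v < y"
        from uv(2) show ?thesis
        proof (rule cases)
          assume "(u', v') \<in> E1"
          with *(1) show ?thesis using arc_diagramsD(4)[OF E1] uv by blast
        qed (use uv y * in auto)
      next
        assume *: "(u, v) \<in> E2" "y < u" "u < v"
        from uv(2) show ?thesis
        proof (rule cases)
          assume "(u', v') \<in> E2"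
          with *(1) show ?thesis using arc_diagramsD(4)[OF E2] uv by blast
        qed (use uv y * in auto)
      qed
    qed
  next
    fix E assume E: "E \<in> arc_diagrams M a b"
    note range = arc_diagramsD(1)[OF E] and cover = arc_diagramsD(2)[OF E]
      and unique = arc_diagramsD(3)[OF E] and nc = arc_diagramsD(4)[OF E]
    obtain u v where uv: "(u, v) \<in> E" "Suc a = u \<or> Suc a = v"
      using cover[of "Suc a"] assms by auto
    with range[OF uv(1)] have "u = Suc a" by auto
    with uv(1) obtain y where yE: "(Suc a, y) \<in> E" by auto
    from range[OF yE] have y: "Suc a < y" "y \<le> b" "M (Suc a) y" by auto
    define E1 where "E1 = {e \<in> E. fst e \<noteq> Suc a \<and> snd e < y}"
    define E2 where "E2 = {e \<in> E. y < fst e}"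
    have trichotomy: "(u, v) = (Suc a, y) \<or> (Suc a < u \<and> u < v \<and> v < y) \<or> (y < u \<and> u < v)"
      if "(u, v) \<in> E" for u v
    proof (cases "{Suc a, y} \<inter> {u, v} = {}")
      case False
      have "Suc a = u \<and> y = v" by (rule unique[OF yE that False])
      then show ?thesis by simp
    next
      case True
      then have "u \<noteq> Suc a" "u \<noteq> y" "v \<noteq> y" by auto
      moreover have "a < u" "u < v" using range[OF that] by auto
      moreover have "\<not> (Suc a < u \<and> u < y \<and> y < v)" using nc[OF yE that] by blast
      ultimately show ?thesis by linarith
    qed
    have E_eq: "E = add_first_arc a (y, E1, E2)"
    proof (intro equalityI subrelI)
      show "(u, v) \<in> add_first_arc a (y, E1, E2)" if "(u, v) \<in> E" for u v
        using trichotomy[OF that] that unfolding add_first_arc_def E1_def E2_def by auto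
      show "(u, v) \<in> E" if "(u, v) \<in> add_first_arc a (y, E1, E2)" for u v
        using that yE unfolding add_first_arc_def E1_def E2_def by auto
    qed
    have in1: "(u, v) \<in> E1 \<longleftrightarrow> (u, v) \<in> E \<and> Suc a < u \<and> v < y" for u v
      using trichotomy[of u v] y unfolding E1_def by auto
    have in2: "(u, v) \<in> E2 \<longleftrightarrow> (u, v) \<in> E \<and> y < u" for u v
      unfolding E2_def by auto
    have "E1 \<in> arc_diagrams M (Suc a) (y - 1)"
    proof (rule arc_diagramsI)
      show "Suc a < u \<and> u < v \<and> v \<le> y - 1 \<and> M u v" if "(u, v) \<in> E1" for u v
        using that range[of u v] by (auto simp: in1)
      show "\<exists>u v. (u, v) \<in> E1 \<and> (z = u \<or> z = v)" if z: "Suc a < z" "z \<le> y - 1" for z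
      proof -
        have "a < z" "z \<le> b" using z y by auto
        then obtain u v where uv: "(u, v) \<in> E" "z = u \<or> z = v"
          using cover by blast
        then show ?thesis using trichotomy[OF uv(1)] z y in1[of u v] by auto
      qed
    qed (use unique nc in \<open>auto simp: in1\<close>)
    moreover have "E2 \<in> arc_diagrams M y b"
    proof (rule arc_diagramsI)
      show "y < u \<and> u < v \<and> v \<le> b \<and> M u v" if "(u, v) \<in> E2" for u v
        using that range[of u v] by (auto simp: in2)
      show "\<exists>u v. (u, v) \<in> E2 \<and> (z = u \<or> z = v)" if z: "y < z" "z \<le> b" for z
      proof -
        have "a < z" "z \<le> b" using z y by auto
        then obtain u v where uv: "(u, v) \<in> E" "z = u \<or> z = v"
          using cover by blast
        then show ?thesis using trichotomy[OF uv(1)] z y in2[of u v] by auto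
      qed
    qed (use unique nc in \<open>auto simp: in2\<close>)
    ultimately show "E \<in> add_first_arc a ` ?S"
      unfolding E_eq using y by (intro imageI) auto
  qed
qed

definition arc_sum :: "(nat \<Rightarrow> nat \<Rightarrow> bool) \<Rightarrow> (nat \<Rightarrow> 'a::comm_semiring_1) \<Rightarrow> nat \<Rightarrow> nat \<Rightarrow> 'a" where
  "arc_sum M w a b = (\<Sum>E\<in>arc_diagrams M a b. \<Prod>e\<in>E. w (snd e))"

lemma arc_sum_empty: "b \<le> a \<Longrightarrow> arc_sum M w a b = 1"
  by (simp add: arc_sum_def arc_diagrams_empty)

lemma arc_sum_first_arc:
  assumes "a < b"
  shows "arc_sum M w a b =
    (\<Sum>y | Suc a < y \<and> y \<le> b \<and> M (Suc a) y. w y * arc_sum M w (Suc a) (y - 1) * arc_sum M w y b)"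
proof -
  let ?Y = "{y. Suc a < y \<and> y \<le> b \<and> M (Suc a) y}"
  let ?S = "SIGMA y:?Y. arc_diagrams M (Suc a) (y - 1) \<times> arc_diagrams M y b"
  have wt: "(\<Prod>e\<in>add_first_arc a (y, E1, E2). w (snd e)) = w y * (\<Prod>e\<in>E1. w (snd e)) * (\<Prod>e\<in>E2. w (snd e))"
    if y: "Suc a < y" and E1: "E1 \<in> arc_diagrams M (Suc a) (y - 1)" and E2: "E2 \<in> arc_diagrams M y b"
    for y E1 E2
  proof -
    have "(Suc a, y) \<notin> E1 \<union> E2" "E1 \<inter> E2 = {}"
      using y arc_diagramsD(1)[OF E1] arc_diagramsD(1)[OF E2] by fastforce+
    then show ?thesis
      unfolding add_first_arc_def using finite_arc_diagram[OF E1] finite_arc_diagram[OF E2]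
      by (simp add: prod.union_disjoint mult.assoc)
  qed
  have "finite ?Y" by simp
  have "arc_sum M w a b = (\<Sum>s\<in>?S. \<Prod>e\<in>add_first_arc a s. w (snd e))"
    unfolding arc_sum_def by (rule sum.reindex_bij_betw[OF bij_betw_add_first_arc[OF assms], symmetric])
  also have "\<dots> = (\<Sum>(y, E1, E2)\<in>?S. w y * (\<Prod>e\<in>E1. w (snd e)) * (\<Prod>e\<in>E2. w (snd e)))"
    by (rule sum.cong) (auto simp: wt)
  also have "\<dots> = (\<Sum>y\<in>?Y. \<Sum>(E1, E2)\<in>arc_diagrams M (Suc a) (y - 1) \<times> arc_diagrams M y b.
                    w y * (\<Prod>e\<in>E1. w (snd e)) * (\<Prod>e\<in>E2. w (snd e)))"
    by (subst sum.Sigma[symmetric]) (auto simp: finite_arc_diagrams)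
  also have "\<dots> = (\<Sum>y\<in>?Y. w y * arc_sum M w (Suc a) (y - 1) * arc_sum M w y b)"
    unfolding arc_sum_def sum.cartesian_product[symmetric]
    by (simp only: mult.assoc sum_distrib_left[symmetric] sum_distrib_right[symmetric])
  finally show ?thesis .
qed

text \<open>The proof uses only the recursion, so that the diagrams themselves need not be translated.\<close>

lemma arc_sum_shift:
  assumes "\<And>x y. 0 < x \<Longrightarrow> x < y \<Longrightarrow> M (x + d) (y + d) = M x y"
    and "\<And>y. 0 < y \<Longrightarrow> w (y + d) = w y"
  shows "arc_sum M w (a + d) (b + d) = arc_sum M w a b"
proof (induction "b - a" arbitrary: a b rule: less_induct)
  case less
  show ?case
  proof (cases "a < b")
    case False
    then show ?thesis by (simp add: arc_sum_empty)
  next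
    case True
    let ?Y = "{y. Suc a < y \<and> y \<le> b \<and> M (Suc a) y}"
    let ?Y' = "{y. Suc (a + d) < y \<and> y \<le> b + d \<and> M (Suc (a + d)) y}"
    have "arc_sum M w (a + d) (b + d)
        = (\<Sum>y\<in>?Y'. w y * arc_sum M w (Suc (a + d)) (y - 1) * arc_sum M w y (b + d))"
      using True by (intro arc_sum_first_arc) simp
    also have "\<dots> = (\<Sum>y\<in>?Y. w y * arc_sum M w (Suc a) (y - 1) * arc_sum M w y b)"
    proof (rule sum.reindex_bij_witness[of _ "\<lambda>y. y + d" "\<lambda>y. y - d"], goal_cases)
      case (2 y)
      then have "M (Suc a + d) (y - d + d) = M (Suc a) (y - d)"
        by (intro assms(1)) auto
      with 2 show ?case by auto
    next
      case (4 y)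
      then show ?case using assms(1)[of "Suc a" y] by auto
    next
      case (5 y)
      then have "arc_sum M w (Suc a + d) (y - d - 1 + d) = arc_sum M w (Suc a) (y - d - 1)"
        using True by (intro less) auto
      moreover have "arc_sum M w (y - d + d) (b + d) = arc_sum M w (y - d) b"
        using True 5 by (intro less) auto
      moreover have "w (y - d + d) = w (y - d)"
        using 5 by (intro assms(2)) auto
      ultimately show ?case using 5 by (simp add: diff_right_commute)
    qed auto
    also have "\<dots> = arc_sum M w a b"
      using True by (rule arc_sum_first_arc[symmetric])
    finally show ?thesis .
  qed
qed

section \<open>Lagrange inversion\<close>

text \<open>
  The equation for \<open>Y\<close> gives \<open>Y\<^sup>m = z \<phi>(Y) Y\<^sup>m\<^sup>-\<^sup>1\<close>, which expresses the coefficient of \<open>z\<^sup>n\<^sup>+\<^sup>1\<close> in a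
  power of \<open>Y\<close> by coefficients of \<open>z\<^sup>n\<close>. The claimed values satisfy the same recursion, because
  \<open>(n + 1) y \<phi>' \<phi>\<^sup>n = y (\<phi>\<^sup>n\<^sup>+\<^sup>1)'\<close>. No compositional inverse occurs, so \<open>\<phi>\<close> may have a constant term
  that is not a unit, as in the application, where it is \<open>t\<^sub>0 \<cdots> t\<^sub>p\<close>.
\<close>
lemma lagrange_inversion:
  fixes Y \<phi> :: "'a::{idom,ring_char_0} fps"
  assumes "Y = fps_X * (\<phi> oo Y)" and "m \<le> n"
  shows "of_nat n * (Y ^ m) $ n = of_nat m * (\<phi> ^ n) $ (n - m)"
  using assms(2)
proof (induction n arbitrary: m)
  case 0
  then show ?case by simp
next
  case (Suc n)
  have Y0: "Y $ 0 = 0"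
    by (subst assms(1)) simp
  show ?case
  proof (cases m)
    case 0
    then show ?thesis by simp
  next
    case (Suc m')
    then have m': "m' \<le> n" using Suc.prems by simp
    have "Y ^ m = fps_X * ((\<phi> oo Y) * Y ^ m')"
      unfolding Suc power_Suc by (subst (1) assms(1)) (simp add: mult.assoc)
    also have "(\<phi> oo Y) * Y ^ m' = (\<phi> * fps_X ^ m') oo Y"
      using Y0 by (simp add: fps_compose_mult_distrib fps_compose_power[symmetric])
    finally have rec: "(Y ^ m) $ Suc n = (\<Sum>i=0..n. (\<phi> * fps_X ^ m') $ i * (Y ^ i) $ n)"
      by (simp add: fps_compose_nth)
    show ?thesis
    proof (cases "n = 0")
      case True
      with m' show ?thesis unfolding rec using Suc by simp
    next
      case False
      \<comment> \<open>by the induction hypothesis; the factor \<open>i\<close> is then absorbed into a derivative\<close>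
      have "of_nat n * (Y ^ m) $ Suc n
          = (\<Sum>i=0..n. (\<phi> * fps_X ^ m') $ i * (of_nat i * (\<phi> ^ n) $ (n - i)))"
        unfolding rec sum_distrib_left
        by (rule sum.cong) (auto simp flip: Suc.IH simp: algebra_simps)
      also have "\<dots> = (\<Sum>i=0..n. (fps_X * fps_deriv (\<phi> * fps_X ^ m')) $ i * (\<phi> ^ n) $ (n - i))"
      proof (rule sum.cong[OF refl])
        fix i assume "i \<in> {0..n}"
        show "(\<phi> * fps_X ^ m') $ i * (of_nat i * (\<phi> ^ n) $ (n - i))
            = (fps_X * fps_deriv (\<phi> * fps_X ^ m')) $ i * (\<phi> ^ n) $ (n - i)"
          by (cases i) (simp_all add: ac_simps del: fps_deriv_mult)
      qed
      also have "\<dots> = (fps_X * fps_deriv (\<phi> * fps_X ^ m') * \<phi> ^ n) $ n"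
        by (simp add: fps_mult_nth)
      finally have eq: "of_nat n * (Y ^ m) $ Suc n = (fps_X * fps_deriv (\<phi> * fps_X ^ m') * \<phi> ^ n) $ n" .
      let ?c = "(\<phi> ^ Suc n) $ (n - m')"
      have "fps_X * fps_deriv (fps_X ^ m') = of_nat m' * (fps_X :: 'a fps) ^ m'"
        using fps_deriv_power'[of "fps_X :: 'a fps" m'] by (cases m') simp_all
      then have "fps_X * fps_deriv (\<phi> * fps_X ^ m') * \<phi> ^ n
          = fps_X ^ m' * (fps_X * (fps_deriv \<phi> * \<phi> ^ n) + of_nat m' * \<phi> ^ Suc n)"
        by (simp add: distrib_left distrib_right mult.assoc mult.left_commute[of fps_X])
      then have eq': "of_nat n * (Y ^ m) $ Suc n
          = (fps_X * (fps_deriv \<phi> * \<phi> ^ n) + of_nat m' * \<phi> ^ Suc n) $ (n - m')"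
        unfolding eq using m' by (simp add: fps_X_power_mult_nth)
      have "of_nat (Suc n) * (fps_X * (fps_deriv \<phi> * \<phi> ^ n)) = fps_X * fps_deriv (\<phi> ^ Suc n)"
        unfolding fps_deriv_power' by (simp add: ac_simps del: of_nat_Suc)
      then have "of_nat (Suc n) * (fps_X * (fps_deriv \<phi> * \<phi> ^ n)) $ (n - m')
          = (fps_X * fps_deriv (\<phi> ^ Suc n)) $ (n - m')"
        by (metis fps_mult_of_nat_nth(1))
      also have "\<dots> = of_nat (n - m') * ?c"
        by (cases "n - m'") (simp_all del: fps_deriv_mult power_Suc)
      finally have "of_nat (Suc n) * (of_nat n * (Y ^ m) $ Suc n)
          = (of_nat (n - m') + of_nat (Suc n) * of_nat m') * ?c"
        unfolding eq' fps_add_nth fps_mult_of_nat_nth distrib_left distrib_right mult.assoc by simp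
      also have "of_nat (n - m') + of_nat (Suc n) * of_nat m' = (of_nat n * of_nat m :: 'a)"
        using m' by (simp add: Suc of_nat_diff algebra_simps)
      finally have "of_nat n * (of_nat (Suc n) * (Y ^ m) $ Suc n) = of_nat n * (of_nat m * ?c)"
        by (simp only: ac_simps)
      with False show ?thesis by (simp add: Suc)
    qed
  qed
qed

lemma fps_const_prod: "fps_const (\<Prod>x\<in>A. f x) = (\<Prod>x\<in>A. fps_const (f x :: 'a::comm_ring_1))"
  by (induction A rule: infinite_finite_induct) (simp_all flip: fps_const_mult)

lemma coeff_power_prod_linear:
  fixes t :: "'i \<Rightarrow> 'a::comm_ring_1"
  assumes "finite A"
  shows "((\<Prod>l\<in>A. fps_const (t l) + fps_X) ^ k) $ n =
    (\<Sum>j | j \<in> A \<rightarrow>\<^sub>E {..k} \<and> (\<Sum>l\<in>A. j l) + n = card A * k.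
       \<Prod>l\<in>A. of_nat (k choose j l) * t l ^ j l)"
proof -
  have "(\<Prod>l\<in>A. fps_const (t l) + fps_X) ^ k
      = (\<Prod>l\<in>A. \<Sum>j\<le>k. fps_const (of_nat (k choose j) * t l ^ j) * fps_X ^ (k - j))"
    unfolding prod_power_distrib
    by (intro prod.cong refl, subst binomial_ring)
       (simp add: fps_of_nat[symmetric] mult.assoc flip: fps_const_mult)
  also have "\<dots> = (\<Sum>j\<in>A \<rightarrow>\<^sub>E {..k}. \<Prod>l\<in>A. fps_const (of_nat (k choose j l) * t l ^ j l) * fps_X ^ (k - j l))"
    using assms by (subst prod_sum_PiE) auto
  also have "\<dots> = (\<Sum>j\<in>A \<rightarrow>\<^sub>E {..k}. fps_const (\<Prod>l\<in>A. of_nat (k choose j l) * t l ^ j l) * fps_X ^ (\<Sum>l\<in>A. k - j l))"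
    by (intro sum.cong refl, subst prod.distrib) (simp add: fps_const_prod power_sum)
  also have "\<dots> $ n = (\<Sum>j\<in>A \<rightarrow>\<^sub>E {..k}. if n = (\<Sum>l\<in>A. k - j l) then \<Prod>l\<in>A. of_nat (k choose j l) * t l ^ j l else 0)"
    by (simp add: fps_sum_nth if_distrib cong: if_cong)
  also have "\<dots> = (\<Sum>j | j \<in> A \<rightarrow>\<^sub>E {..k} \<and> n = (\<Sum>l\<in>A. k - j l).
       \<Prod>l\<in>A. of_nat (k choose j l) * t l ^ j l)"
    using assms by (intro sum.inter_filter[symmetric] finite_PiE) auto
  also have "{j. j \<in> A \<rightarrow>\<^sub>E {..k} \<and> n = (\<Sum>l\<in>A. k - j l)}
      = {j. j \<in> A \<rightarrow>\<^sub>E {..k} \<and> (\<Sum>l\<in>A. j l) + n = card A * k}"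
  proof -
    have "(n = (\<Sum>l\<in>A. k - j l)) = ((\<Sum>l\<in>A. j l) + n = card A * k)" if "j \<in> A \<rightarrow>\<^sub>E {..k}" for j
    proof -
      have "(\<Sum>l\<in>A. j l) + (\<Sum>l\<in>A. k - j l) = (\<Sum>l\<in>A. k)"
        unfolding sum.distrib[symmetric] using that by (intro sum.cong) (auto simp: PiE_iff)
      then show ?thesis by auto
    qed
    then show ?thesis by blast
  qed
  finally show ?thesis .
qed

section \<open>Arc diagrams over the zigzag path\<close>

text \<open>The height after \<open>x\<close> steps.\<close>
definition zigzag :: "nat \<Rightarrow> nat \<Rightarrow> nat" where
  "zigzag p x = min (x mod (2 * p)) (2 * p - x mod (2 * p))"

definition closes :: "nat \<Rightarrow> nat \<Rightarrow> nat \<Rightarrow> bool" where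
  "closes p x y \<longleftrightarrow> zigzag p (x - 1) = zigzag p y \<and> zigzag p x = zigzag p (y - 1)"

text \<open>A right leg is weighted by the height from which its step starts.\<close>
definition path_sum :: "nat \<Rightarrow> (nat \<Rightarrow> 'a::comm_semiring_1) \<Rightarrow> nat \<Rightarrow> nat \<Rightarrow> 'a" where
  "path_sum p t = arc_sum (closes p) (\<lambda>y. t (zigzag p (y - 1)))"

lemma zigzag_add_period [simp]: "zigzag p (x + 2 * p * m) = zigzag p x"
  by (simp add: zigzag_def)

lemma zigzag_up: "r \<le> p \<Longrightarrow> zigzag p (2 * p * m + r) = r"
  by (cases "r = p"; cases "p = 0") (auto simp: zigzag_def add.commute)

lemma zigzag_down: "r \<le> p \<Longrightarrow> zigzag p (2 * p * m + (2 * p - r)) = r"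
proof (cases "r = 0")
  case False
  assume "r \<le> p"
  with False have "(2 * p * m + (2 * p - r)) mod (2 * p) = 2 * p - r"
    unfolding mod_mult_self4 by (intro mod_less) simp
  with \<open>r \<le> p\<close> show ?thesis by (simp add: zigzag_def)
qed (simp add: zigzag_def)

lemma path_sum_shift:
  "path_sum p t (a + 2 * p * m) (b + 2 * p * m) = path_sum p t a b"
  unfolding path_sum_def
proof (rule arc_sum_shift)
  have *: "zigzag p (x + 2 * p * m - 1) = zigzag p (x - 1)" if "0 < x" for x
    using zigzag_add_period[of p "x - 1" m] that by simp
  then show "t (zigzag p (y + 2 * p * m - 1)) = t (zigzag p (y - 1))" if "0 < y" for y
    using that by simp
  show "closes p (x + 2 * p * m) (y + 2 * p * m) = closes p x y" if "0 < x" "x < y" for x y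
    using that * unfolding closes_def by simp
qed

lemma step_cases:
  assumes "0 < p" "0 < y"
  obtains (up) m l where "l < p" "y = 2 * p * m + Suc l"
  | (down) m l where "0 < l" "l \<le> p" "y = 2 * p * m + (2 * p - l) + 1"
proof -
  define r where "r = (y - 1) mod (2 * p)"
  define m where "m = (y - 1) div (2 * p)"
  have "y - 1 = 2 * p * m + r" unfolding r_def m_def by simp
  with assms(2) have y: "y = 2 * p * m + Suc r" by simp
  have "r < 2 * p" using assms(1) unfolding r_def by simp
  show ?thesis
  proof (cases "r < p")
    case True
    with y show ?thesis by (rule up[rotated])
  next
    case False
    with \<open>r < 2 * p\<close> y show ?thesis by (intro down[of "2 * p - r" m]) auto
  qed
qed

text \<open>
  The steps that undo the step up from height \<open>l\<close> are the steps down to \<open>l\<close>, one in each period;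
  the next lemma is its mirror image.
\<close>
lemma closes_up_iff:
  assumes "l < p" "0 < y"
  shows "closes p (Suc l) y \<longleftrightarrow> (\<exists>m>0. y = 2 * p * m - l)"
proof -
  have start: "zigzag p l = l" "zigzag p (Suc l) = Suc l"
    using zigzag_up[of l p 0] zigzag_up[of "Suc l" p 0] assms by auto
  have "0 < p" using assms by simp
  show ?thesis
  proof
    assume "closes p (Suc l) y"
    then have h: "zigzag p y = l" "zigzag p (y - 1) = Suc l"
      unfolding closes_def using start by auto
    from \<open>0 < p\<close> \<open>0 < y\<close> show "\<exists>m>0. y = 2 * p * m - l"
    proof (cases rule: step_cases)
      case (up m r)
      with h zigzag_up[of "Suc r" p m] zigzag_up[of r p m] show ?thesis by simp
    next
      case (down m r)
      then have "zigzag p (y - 1) = r" using zigzag_down[of r p m] by simp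
      with h down have "y = 2 * p * Suc m - l" by auto
      then show ?thesis by blast
    qed
  next
    assume "\<exists>m>0. y = 2 * p * m - l"
    then obtain m where "y = 2 * p * Suc m - l"
      by (metis Suc_pred')
    then have "y = 2 * p * m + (2 * p - l)" "y - 1 = 2 * p * m + (2 * p - Suc l)"
      using assms by auto
    then show "closes p (Suc l) y"
      unfolding closes_def using start zigzag_down[of l p m] zigzag_down[of "Suc l" p m] assms by simp
  qed
qed

lemma closes_down_iff:
  assumes "0 < l" "l \<le> p" "0 < y"
  shows "closes p (Suc (2 * p - l)) y \<longleftrightarrow> (\<exists>m. y = 2 * p * m + l)"
proof -
  have start: "zigzag p (2 * p - l) = l" "zigzag p (Suc (2 * p - l)) = l - 1"
    using zigzag_down[of l p 0] zigzag_down[of "l - 1" p 0] assms by (auto simp: Suc_diff_le)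
  have "0 < p" using assms by simp
  show ?thesis
  proof
    assume "closes p (Suc (2 * p - l)) y"
    then have h: "zigzag p y = l" "zigzag p (y - 1) = l - 1"
      unfolding closes_def using start by auto
    from \<open>0 < p\<close> \<open>0 < y\<close> show "\<exists>m. y = 2 * p * m + l"
    proof (cases rule: step_cases)
      case (up m r)
      with h zigzag_up[of "Suc r" p m] have "y = 2 * p * m + l" by simp
      then show ?thesis ..
    next
      case (down m r)
      then have "zigzag p (y - 1) = r" using zigzag_down[of r p m] by simp
      moreover have "zigzag p y = r - 1"
        using down zigzag_down[of "r - 1" p m] by (auto simp: Suc_diff_le)
      ultimately show ?thesis using h assms down by simp
    qed
  next
    assume "\<exists>m. y = 2 * p * m + l"
    then obtain m where "y = 2 * p * m + l" ..
    moreover from this have "y - 1 = 2 * p * m + (l - 1)" using assms by simp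
    ultimately show "closes p (Suc (2 * p - l)) y"
      unfolding closes_def using start zigzag_up[of l p m] zigzag_up[of "l - 1" p m] assms by simp
  qed
qed

text \<open>
  The first arc starts with the step up at \<open>l\<close> and ends with the step down to \<open>l\<close> in the \<open>m\<close>-th
  period. The bound \<open>n\<close> numbers the last period whose step down to \<open>l\<close> lies on the path; it depends
  on the kind of end point \<open>b\<close>.
\<close>
lemma path_sum_up:
  assumes "l < p" "l < b" "\<And>m. 2 * p * m - l \<le> b \<longleftrightarrow> m \<le> n"
  shows "path_sum p t l b =
    (\<Sum>m=1..n. t (Suc l) * path_sum p t (Suc l) (2 * p * m - Suc l) * path_sum p t (2 * p * m - l) b)"
proof -
  let ?Y = "{y. Suc l < y \<and> y \<le> b \<and> closes p (Suc l) y}"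
  have mono: "Suc l < 2 * p * m - l" if "0 < m" for m
  proof -
    have "2 * p * 1 \<le> 2 * p * m" using that by (intro mult_le_mono2) simp
    with assms(1) show ?thesis by linarith
  qed
  have Y: "?Y = (\<lambda>m. 2 * p * m - l) ` {1..n}"
  proof (intro equalityI subsetI)
    fix y assume y: "y \<in> ?Y"
    then obtain m where "0 < m" "y = 2 * p * m - l"
      using assms(1) closes_up_iff[of l p y] by auto
    with y assms(3) show "y \<in> (\<lambda>m. 2 * p * m - l) ` {1..n}" by auto
  next
    fix y assume "y \<in> (\<lambda>m. 2 * p * m - l) ` {1..n}"
    then obtain m where m: "m \<in> {1..n}" and "y = 2 * p * m - l" by blast
    moreover have "0 < m" "m \<le> n" using m by auto
    ultimately show "y \<in> ?Y"
      using closes_up_iff[of l p y] assms mono[of m] by auto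
  qed
  have inj: "inj_on (\<lambda>m. 2 * p * m - l) {1..n}"
  proof (rule inj_onI)
    fix m m' assume *: "m \<in> {1..n}" "m' \<in> {1..n}" "2 * p * m - l = 2 * p * m' - l"
    then have "Suc l < 2 * p * m - l" "Suc l < 2 * p * m' - l" by (auto intro: mono)
    with *(3) have "2 * p * m = 2 * p * m'" by linarith
    with assms(1) show "m = m'" by simp
  qed
  have "path_sum p t l b = (\<Sum>y\<in>?Y. t (zigzag p (y - 1)) * path_sum p t (Suc l) (y - 1) * path_sum p t y b)"
    unfolding path_sum_def using assms by (intro arc_sum_first_arc)
  also have "\<dots> = (\<Sum>m=1..n. t (zigzag p (2 * p * m - l - 1)) * path_sum p t (Suc l) (2 * p * m - l - 1)
                    * path_sum p t (2 * p * m - l) b)"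
    unfolding Y by (subst sum.reindex[OF inj]) simp
  also have "\<dots> = (\<Sum>m=1..n. t (Suc l) * path_sum p t (Suc l) (2 * p * m - Suc l) * path_sum p t (2 * p * m - l) b)"
  proof (rule sum.cong[OF refl])
    fix m assume "m \<in> {1..n}"
    then obtain m' where m: "m = Suc m'" by (cases m) auto
    have "2 * p * m - l - 1 = 2 * p * m' + (2 * p - Suc l)"
      using assms(1) unfolding m by simp
    with zigzag_down[of "Suc l" p m'] assms(1) have "zigzag p (2 * p * m - l - 1) = Suc l" by simp
    then show "t (zigzag p (2 * p * m - l - 1)) * path_sum p t (Suc l) (2 * p * m - l - 1) * path_sum p t (2 * p * m - l) b
        = t (Suc l) * path_sum p t (Suc l) (2 * p * m - Suc l) * path_sum p t (2 * p * m - l) b"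
      by simp
  qed
  finally show ?thesis .
qed

lemma path_sum_down:
  assumes "0 < l" "l \<le> p" "2 * p - l < b" "\<And>m. 2 * p + 2 * p * m + l \<le> b \<longleftrightarrow> m < n"
  shows "path_sum p t (2 * p - l) b =
    (\<Sum>m<n. t (l - 1) * path_sum p t (2 * p - (l - 1)) (2 * p + (l - 1) + 2 * p * m)
                * path_sum p t (2 * p + 2 * p * m + l) b)"
proof -
  let ?Y = "{y. Suc (2 * p - l) < y \<and> y \<le> b \<and> closes p (Suc (2 * p - l)) y}"
  have Y: "?Y = (\<lambda>m. 2 * p + 2 * p * m + l) ` {..<n}"
  proof (intro equalityI subsetI)
    fix y assume y: "y \<in> ?Y"
    then obtain m where m: "y = 2 * p * m + l"
      using closes_down_iff[of l p y] assms(1,2) by auto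
    have "m \<noteq> 0"
    proof
      assume "m = 0"
      with m y have "Suc (2 * p - l) < l" by simp
      with assms(2) show False by linarith
    qed
    then obtain m' where "m = Suc m'" by (cases m) simp
    with m have y': "y = 2 * p + 2 * p * m' + l" by simp
    with y assms(4)[of m'] have "m' < n" by simp
    with y' show "y \<in> (\<lambda>m. 2 * p + 2 * p * m + l) ` {..<n}"
      by (intro image_eqI[of _ _ m']) simp_all
  next
    fix y assume "y \<in> (\<lambda>m. 2 * p + 2 * p * m + l) ` {..<n}"
    then obtain m where m: "m < n" and y: "y = 2 * p + 2 * p * m + l" by auto
    have "closes p (Suc (2 * p - l)) y"
      using closes_down_iff[of l p y] assms(1,2) y by (auto intro!: exI[of _ "Suc m"])
    moreover have "y \<le> b" using assms(4)[of m] m y by simp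
    moreover have "Suc (2 * p - l) < y" using y assms(1,2) by linarith
    ultimately show "y \<in> ?Y" by simp
  qed
  have inj: "inj_on (\<lambda>m. 2 * p + 2 * p * m + l) {..<n}"
    using assms(1,2) by (auto simp: inj_on_def)
  have "path_sum p t (2 * p - l) b = (\<Sum>y\<in>?Y. t (zigzag p (y - 1)) * path_sum p t (Suc (2 * p - l)) (y - 1) * path_sum p t y b)"
    unfolding path_sum_def using assms by (intro arc_sum_first_arc)
  also have "\<dots> = (\<Sum>m<n. t (zigzag p (2 * p + 2 * p * m + l - 1)) * path_sum p t (Suc (2 * p - l)) (2 * p + 2 * p * m + l - 1)
                    * path_sum p t (2 * p + 2 * p * m + l) b)"
    unfolding Y by (subst sum.reindex[OF inj]) simp
  also have "\<dots> = (\<Sum>m<n. t (l - 1) * path_sum p t (2 * p - (l - 1)) (2 * p + (l - 1) + 2 * p * m)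
                * path_sum p t (2 * p + 2 * p * m + l) b)"
  proof (rule sum.cong[OF refl])
    fix m
    have 1: "2 * p + 2 * p * m + l - 1 = 2 * p + (l - 1) + 2 * p * m"
      and 2: "Suc (2 * p - l) = 2 * p - (l - 1)"
      using assms by auto
    have "zigzag p (2 * p + (l - 1) + 2 * p * m) = l - 1"
      using zigzag_up[of "l - 1" p "Suc m"] assms by (simp add: ac_simps)
    then show "t (zigzag p (2 * p + 2 * p * m + l - 1)) * path_sum p t (Suc (2 * p - l)) (2 * p + 2 * p * m + l - 1)
                    * path_sum p t (2 * p + 2 * p * m + l) b
       = t (l - 1) * path_sum p t (2 * p - (l - 1)) (2 * p + (l - 1) + 2 * p * m)
                * path_sum p t (2 * p + 2 * p * m + l) b"
      unfolding 1 2 by simp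
  qed
  finally show ?thesis .
qed

section \<open>Generating functions of the path pieces\<close>
context
  fixes p :: nat and t :: "nat \<Rightarrow> 'a::idom"
begin

text \<open>
  The four families of pieces that begin and end at height \<open>l\<close>: a hill begins on the way up and ends
  on the way down, a valley the other way round; the pieces in \<open>up_fps\<close> (\<open>down_fps\<close>) are whole
  numbers of periods beginning and ending on the way up (down). The variable marks the peaks that a
  piece passes. At \<open>l = p\<close> the way up ends and the way down begins at the same point, before and after
  passing the peak; so the shortest hill there has no steps but one peak. At \<open>l = 0\<close> the same holds
  for the turning points at the bottom, which carry no mark. A hill passes at least one peak, which
  is why its constant term is \<open>0\<close>.
\<close>
definition hill_fps :: "nat \<Rightarrow> 'a fps" where
  "hill_fps l = Abs_fps (\<lambda>n. if n = 0 then 0 else path_sum p t l (2 * p * n - l))"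

definition valley_fps :: "nat \<Rightarrow> 'a fps" where
  "valley_fps l = Abs_fps (\<lambda>n. path_sum p t (2 * p - l) (2 * p + l + 2 * p * n))"

definition up_fps :: "nat \<Rightarrow> 'a fps" where
  "up_fps l = Abs_fps (\<lambda>n. path_sum p t l (l + 2 * p * n))"

definition down_fps :: "nat \<Rightarrow> 'a fps" where
  "down_fps l = Abs_fps (\<lambda>n. path_sum p t (2 * p - l) (2 * p - l + 2 * p * n))"

lemma const_mult_mult_nth:
  "(fps_const c * f * g) $ n = (\<Sum>m\<le>n. c * f $ m * g $ (n - m))" for c :: 'a
  by (subst fps_mult_nth) (simp add: atMost_atLeast0)

lemma sum_from_1_conv_mult_nth:
  assumes "f $ 0 = (0 :: 'a)"
  shows "(\<Sum>m=1..n. c * f $ m * g $ (n - m)) = (fps_const c * f * g) $ n"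
  using assms by (simp add: const_mult_mult_nth atMost_atLeast0 sum.atLeast_Suc_atMost)

text \<open>
  In the following four relations the first arc encloses a piece one level up or down, at height
  \<open>l + 1\<close> a hill and at height \<open>l - 1\<close> a valley, and what remains is a piece at height \<open>l\<close> that
  begins in the opposite direction.
\<close>
lemma up_eq:
  assumes "l < p"
  shows "up_fps l = 1 + fps_const (t (Suc l)) * hill_fps (Suc l) * valley_fps l"
proof (rule fps_ext)
  fix n
  show "up_fps l $ n = (1 + fps_const (t (Suc l)) * hill_fps (Suc l) * valley_fps l) $ n"
  proof (cases "n = 0")
    case True
    then show ?thesis by (simp add: up_fps_def path_sum_def arc_sum_empty hill_fps_def)
  next
    case False
    have iff: "2 * p * m - l \<le> l + 2 * p * n \<longleftrightarrow> m \<le> n" for m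
    proof
      assume "m \<le> n"
      then have "2 * p * m \<le> 2 * p * n" by (rule mult_le_mono2)
      then show "2 * p * m - l \<le> l + 2 * p * n" by linarith
    next
      assume le: "2 * p * m - l \<le> l + 2 * p * n"
      show "m \<le> n"
      proof (rule ccontr)
        assume "\<not> m \<le> n"
        then have "2 * p * Suc n \<le> 2 * p * m" by (intro mult_le_mono2) simp
        with le assms show False by simp
      qed
    qed
    have "up_fps l $ n = (\<Sum>m=1..n. t (Suc l) * path_sum p t (Suc l) (2 * p * m - Suc l)
        * path_sum p t (2 * p * m - l) (l + 2 * p * n))"
      unfolding up_fps_def fps_nth_Abs_fps by (rule path_sum_up) (use assms False iff in auto)
    also have "\<dots> = (\<Sum>m=1..n. t (Suc l) * hill_fps (Suc l) $ m * valley_fps l $ (n - m))"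
    proof (rule sum.cong[OF refl])
      fix m assume m: "m \<in> {1..n}"
      then obtain j i where j: "m = Suc j" and i: "n = m + i" by (cases m) (auto simp: le_iff_add)
      have "path_sum p t (2 * p * m - l) (l + 2 * p * n)
          = path_sum p t (2 * p - l + 2 * p * j) (2 * p + l + 2 * p * i + 2 * p * j)"
        using assms unfolding j i by (intro arg_cong2[of _ _ _ _ "path_sum p t"]) (auto simp: algebra_simps)
      also have "\<dots> = valley_fps l $ (n - m)"
        unfolding path_sum_shift by (simp add: valley_fps_def i)
      finally show "t (Suc l) * path_sum p t (Suc l) (2 * p * m - Suc l) * path_sum p t (2 * p * m - l) (l + 2 * p * n)
        = t (Suc l) * hill_fps (Suc l) $ m * valley_fps l $ (n - m)"
        using m by (simp add: hill_fps_def)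
    qed
    also have "\<dots> = (fps_const (t (Suc l)) * hill_fps (Suc l) * valley_fps l) $ n"
      by (rule sum_from_1_conv_mult_nth) (simp add: hill_fps_def)
    finally show ?thesis using False by simp
  qed
qed

lemma hill_eq:
  assumes "l < p"
  shows "hill_fps l = fps_const (t (Suc l)) * hill_fps (Suc l) * down_fps l"
proof (rule fps_ext)
  fix n
  show "hill_fps l $ n = (fps_const (t (Suc l)) * hill_fps (Suc l) * down_fps l) $ n"
  proof (cases "n = 0")
    case True
    then show ?thesis by (simp add: hill_fps_def)
  next
    case False
    then have "2 * p * 1 \<le> 2 * p * n" by (intro mult_le_mono2) simp
    with assms have l: "l < 2 * p * n - l" by linarith
    have iff: "2 * p * m - l \<le> 2 * p * n - l \<longleftrightarrow> m \<le> n" for m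
    proof -
      have "2 * p * m - l \<le> 2 * p * n - l \<longleftrightarrow> 2 * p * m \<le> 2 * p * n"
        using l by linarith
      then show ?thesis using assms by simp
    qed
    have "hill_fps l $ n = (\<Sum>m=1..n. t (Suc l) * path_sum p t (Suc l) (2 * p * m - Suc l)
        * path_sum p t (2 * p * m - l) (2 * p * n - l))"
      using False path_sum_up[OF assms l iff] by (simp add: hill_fps_def)
    also have "\<dots> = (\<Sum>m=1..n. t (Suc l) * hill_fps (Suc l) $ m * down_fps l $ (n - m))"
    proof (rule sum.cong[OF refl])
      fix m assume m: "m \<in> {1..n}"
      then obtain j i where j: "m = Suc j" and i: "n = m + i" by (cases m) (auto simp: le_iff_add)
      have "path_sum p t (2 * p * m - l) (2 * p * n - l)
          = path_sum p t (2 * p - l + 2 * p * j) (2 * p - l + 2 * p * i + 2 * p * j)"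
        using assms unfolding j i by (intro arg_cong2[of _ _ _ _ "path_sum p t"]) (auto simp: algebra_simps)
      also have "\<dots> = down_fps l $ (n - m)"
        unfolding path_sum_shift by (simp add: down_fps_def i)
      finally show "t (Suc l) * path_sum p t (Suc l) (2 * p * m - Suc l) * path_sum p t (2 * p * m - l) (2 * p * n - l)
        = t (Suc l) * hill_fps (Suc l) $ m * down_fps l $ (n - m)"
        using m by (simp add: hill_fps_def)
    qed
    also have "\<dots> = (fps_const (t (Suc l)) * hill_fps (Suc l) * down_fps l) $ n"
      by (rule sum_from_1_conv_mult_nth) (simp add: hill_fps_def)
    finally show ?thesis .
  qed
qed

lemma valley_eq:
  assumes "0 < l" "l \<le> p"
  shows "valley_fps l = fps_const (t (l - 1)) * valley_fps (l - 1) * up_fps l"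
proof (rule fps_ext)
  fix n
  have iff: "2 * p + 2 * p * m + l \<le> 2 * p + l + 2 * p * n \<longleftrightarrow> m < Suc n" for m
    using assms by auto
  have "valley_fps l $ n = (\<Sum>m<Suc n. t (l - 1) * path_sum p t (2 * p - (l - 1)) (2 * p + (l - 1) + 2 * p * m)
                * path_sum p t (2 * p + 2 * p * m + l) (2 * p + l + 2 * p * n))"
    unfolding valley_fps_def fps_nth_Abs_fps by (rule path_sum_down) (use assms iff in auto)
  also have "\<dots> = (\<Sum>m<Suc n. t (l - 1) * valley_fps (l - 1) $ m * up_fps l $ (n - m))"
  proof (rule sum.cong[OF refl])
    fix m assume "m \<in> {..<Suc n}"
    then obtain i where i: "n = m + i" by (auto simp: less_Suc_eq_le le_iff_add)
    have "path_sum p t (2 * p + 2 * p * m + l) (2 * p + l + 2 * p * n)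
        = path_sum p t (l + 2 * p * Suc m) (l + 2 * p * i + 2 * p * Suc m)"
      unfolding i by (intro arg_cong2[of _ _ _ _ "path_sum p t"]) (auto simp: algebra_simps)
    also have "\<dots> = up_fps l $ (n - m)"
      unfolding path_sum_shift by (simp add: up_fps_def i)
    finally show "t (l - 1) * path_sum p t (2 * p - (l - 1)) (2 * p + (l - 1) + 2 * p * m)
                * path_sum p t (2 * p + 2 * p * m + l) (2 * p + l + 2 * p * n)
        = t (l - 1) * valley_fps (l - 1) $ m * up_fps l $ (n - m)"
      by (simp add: valley_fps_def)
  qed
  also have "\<dots> = (fps_const (t (l - 1)) * valley_fps (l - 1) * up_fps l) $ n"
    unfolding lessThan_Suc_atMost by (rule const_mult_mult_nth[symmetric])
  finally show "valley_fps l $ n = (fps_const (t (l - 1)) * valley_fps (l - 1) * up_fps l) $ n" .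
qed

lemma down_eq:
  assumes "0 < l" "l \<le> p"
  shows "down_fps l = 1 + fps_const (t (l - 1)) * valley_fps (l - 1) * hill_fps l"
proof (rule fps_ext)
  fix n
  show "down_fps l $ n = (1 + fps_const (t (l - 1)) * valley_fps (l - 1) * hill_fps l) $ n"
  proof (cases "n = 0")
    case True
    then show ?thesis by (simp add: down_fps_def path_sum_def arc_sum_empty hill_fps_def)
  next
    case False
    have iff: "2 * p + 2 * p * m + l \<le> 2 * p - l + 2 * p * n \<longleftrightarrow> m < n" for m
    proof
      assume "m < n"
      then have "2 * p * Suc m \<le> 2 * p * n" by (intro mult_le_mono2) simp
      then show "2 * p + 2 * p * m + l \<le> 2 * p - l + 2 * p * n" using assms by simp
    next
      assume le: "2 * p + 2 * p * m + l \<le> 2 * p - l + 2 * p * n"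
      show "m < n"
      proof (rule ccontr)
        assume "\<not> m < n"
        then have "2 * p * n \<le> 2 * p * m" by (intro mult_le_mono2) simp
        with le assms show False by linarith
      qed
    qed
    have "0 < p" using assms by simp
    with False have later: "2 * p - l < 2 * p - l + 2 * p * n" by simp
    have "down_fps l $ n = (\<Sum>m<n. t (l - 1) * path_sum p t (2 * p - (l - 1)) (2 * p + (l - 1) + 2 * p * m)
                * path_sum p t (2 * p + 2 * p * m + l) (2 * p - l + 2 * p * n))"
      unfolding down_fps_def fps_nth_Abs_fps by (rule path_sum_down[OF assms later iff])
    also have "\<dots> = (\<Sum>m<n. t (l - 1) * valley_fps (l - 1) $ m * hill_fps l $ (n - m))"
    proof (rule sum.cong[OF refl])
      fix m assume "m \<in> {..<n}"
      then have m: "m < n" by simp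
      then obtain i where i: "n = m + Suc i" by (metis less_iff_Suc_add add_Suc_right)
      have "path_sum p t (2 * p + 2 * p * m + l) (2 * p - l + 2 * p * n)
          = path_sum p t (l + 2 * p * Suc m) (2 * p * (n - m) - l + 2 * p * Suc m)"
        using assms unfolding i by (intro arg_cong2[of _ _ _ _ "path_sum p t"]) (auto simp: algebra_simps)
      also have "\<dots> = hill_fps l $ (n - m)"
        unfolding path_sum_shift using m by (simp add: hill_fps_def)
      finally show "t (l - 1) * path_sum p t (2 * p - (l - 1)) (2 * p + (l - 1) + 2 * p * m)
                * path_sum p t (2 * p + 2 * p * m + l) (2 * p - l + 2 * p * n)
          = t (l - 1) * valley_fps (l - 1) $ m * hill_fps l $ (n - m)"
        by (simp add: valley_fps_def)
    qed
    also have "\<dots> = (\<Sum>m\<le>n. t (l - 1) * valley_fps (l - 1) $ m * hill_fps l $ (n - m))"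
      by (simp add: lessThan_Suc_atMost[symmetric] hill_fps_def)
    also have "\<dots> = (fps_const (t (l - 1)) * valley_fps (l - 1) * hill_fps l) $ n"
      by (rule const_mult_mult_nth[symmetric])
    finally show ?thesis using False by simp
  qed
qed

lemma boundary_eqs:
  shows "valley_fps 0 = down_fps 0" and "up_fps 0 = down_fps 0"
    and "up_fps p = down_fps p" and "hill_fps p = fps_X * down_fps p"
proof -
  show "valley_fps 0 = down_fps 0" by (simp add: valley_fps_def down_fps_def)
  show "up_fps 0 = down_fps 0"
  proof (rule fps_ext)
    fix n show "up_fps 0 $ n = down_fps 0 $ n"
      using path_sum_shift[of p t 0 1 "2 * p * n"] by (simp add: up_fps_def down_fps_def add.commute)
  qed
  show "up_fps p = down_fps p" by (simp add: up_fps_def down_fps_def)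
  show "hill_fps p = fps_X * down_fps p"
  proof (rule fps_ext)
    fix n show "hill_fps p $ n = (fps_X * down_fps p) $ n"
      by (cases n) (simp_all add: hill_fps_def down_fps_def)
  qed
qed

lemma fixed_point_unique:
  fixes A B c :: "'a fps"
  assumes "A = 1 + c * A" "B = 1 + c * B" "c $ 0 = 0"
  shows "A = B"
proof -
  have "(1 - c) * (A - B) = (A - c * A) - (B - c * B)"
    by (simp add: algebra_simps)
  moreover have "A - c * A = 1" "B - c * B = 1"
    using assms(1,2) by (simp_all add: algebra_simps)
  ultimately have "(1 - c) * (A - B) = 0" by simp
  moreover have "1 - c \<noteq> 0"
  proof
    assume "1 - c = 0"
    then have "(1 - c) $ 0 = 0" by simp
    with assms(3) show False by simp
  qed
  ultimately show ?thesis by simp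
qed

lemma hill_fps_nth_0 [simp]: "hill_fps l $ 0 = 0"
  by (simp add: hill_fps_def)

text \<open>
  An arc with everything that it encloses, attached to height \<open>l\<close> from above or from below. At the
  ends of the range turning around takes the place of an arc: at height \<open>p\<close> it contributes the mark
  of a peak, and at height \<open>0\<close> the factor \<open>1\<close>.
\<close>
definition above :: "nat \<Rightarrow> 'a fps" where
  "above l = (if l < p then fps_const (t (Suc l)) * hill_fps (Suc l) else fps_X)"

definition below :: "nat \<Rightarrow> 'a fps" where
  "below l = (if l = 0 then 1 else fps_const (t (l - 1)) * valley_fps (l - 1))"

text \<open>
  Whole periods that begin on the way up and those that begin on the way down are counted by the
  same series, since both solve the same equation \<open>A = 1 + c A\<close>. This turns the four relations into
  one unknown per height.
\<close>
lemma corner_eqs: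
  assumes "0 < p" "l \<le> p"
  shows "down_fps l = 1 + below l * above l * down_fps l"
    and "hill_fps l = above l * down_fps l" and "valley_fps l = below l * down_fps l"
proof -
  have above0: "above l $ 0 = 0" by (simp add: above_def)
  show hill: "hill_fps l = above l * down_fps l"
    using hill_eq[of l] boundary_eqs(4) assms by (cases "l = p") (auto simp: above_def)
  have down: "down_fps l = 1 + below l * above l * down_fps l" if "0 < l"
  proof -
    have "down_fps l = 1 + below l * hill_fps l"
      using down_eq[OF that assms(2)] that by (simp add: below_def)
    also have "below l * hill_fps l = below l * above l * down_fps l"
      unfolding hill by (simp add: mult.assoc)
    finally show ?thesis .
  qed
  have up: "up_fps l = down_fps l" if "0 < l"
  proof (cases "l = p")
    case True
    then show ?thesis using boundary_eqs(3) by simp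
  next
    case False
    then have "up_fps l = 1 + above l * valley_fps l"
      using up_eq[of l] assms by (simp add: above_def)
    also have "valley_fps l = below l * up_fps l"
      using valley_eq[OF that assms(2)] that by (simp add: below_def)
    also have "above l * (below l * up_fps l) = below l * above l * up_fps l"
      by (simp add: ac_simps)
    finally have "up_fps l = 1 + below l * above l * up_fps l" .
    then show ?thesis
      by (rule fixed_point_unique[OF _ down[OF that]]) (simp add: above0)
  qed
  show "valley_fps l = below l * down_fps l"
    using valley_eq[of l] up boundary_eqs(1) assms by (cases "l = 0") (auto simp: below_def)
  show "down_fps l = 1 + below l * above l * down_fps l"
  proof (cases "l = 0")
    case True
    have "up_fps 0 = 1 + above 0 * valley_fps 0"
      using up_eq[OF assms(1)] assms by (simp add: above_def)
    moreover have "below 0 = 1" by (simp add: below_def)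
    ultimately show ?thesis unfolding True boundary_eqs(1,2) by (simp only: mult_1)
  qed (use down in simp)
qed

text \<open>
  The series \<open>X\<^sub>l\<close> of the introduction. In terms of the plane trees that arc diagrams encode, it
  counts the trees whose root has height \<open>l\<close>, with the root weighted as well.
\<close>
definition planted :: "nat \<Rightarrow> 'a fps" where
  "planted l = fps_const (t l) * down_fps l"

lemma below_eq_prod:
  assumes "0 < p" "l \<le> p"
  shows "below l = (\<Prod>i<l. planted i)"
  using assms(2)
proof (induction l)
  case 0
  then show ?case by (simp add: below_def)
next
  case (Suc l)
  have "below (Suc l) = planted l * below l"
    using corner_eqs(3)[of l] assms(1) Suc.prems by (simp add: below_def planted_def ac_simps)
  with Suc show ?case by (simp add: mult.commute)
qed

lemma above_eq_prod:
  assumes "0 < p" "l \<le> p"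
  shows "above l = fps_X * (\<Prod>i\<in>{l<..p}. planted i)"
  using assms(2)
proof (induction l rule: inc_induct)
  case base
  then show ?case by (simp add: above_def)
next
  case (step l)
  have "above l = planted (Suc l) * above (Suc l)"
    using corner_eqs(2)[of "Suc l"] assms(1) step.hyps
    by (auto simp: above_def planted_def ac_simps)
  moreover have "{l<..p} = insert (Suc l) {Suc l<..p}"
    using step.hyps by auto
  ultimately show ?case using step.IH by (simp add: ac_simps)
qed

text \<open>
  What is attached from below multiplies the series of all lower heights, what is attached from
  above those of all greater heights; together with \<open>X\<^sub>l\<close> itself the product runs over all heights
  and no longer depends on \<open>l\<close>.
\<close>
lemma planted_eq:
  assumes "0 < p" "l \<le> p"
  shows "planted l = fps_const (t l) + fps_X * (\<Prod>i\<le>p. planted i)"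
proof -
  have "planted l = fps_const (t l) * (1 + below l * above l * down_fps l)"
    unfolding planted_def by (rule arg_cong[OF corner_eqs(1)[OF assms]])
  also have "\<dots> = fps_const (t l) + below l * above l * planted l"
    by (simp add: planted_def algebra_simps)
  also have "below l * above l * planted l
      = fps_X * ((\<Prod>i<l. planted i) * (planted l * (\<Prod>i\<in>{l<..p}. planted i)))"
    unfolding below_eq_prod[OF assms] above_eq_prod[OF assms] by (simp add: ac_simps)
  also have "planted l * (\<Prod>i\<in>{l<..p}. planted i) = (\<Prod>i\<in>{l..p}. planted i)"
    using assms by (subst prod.head) simp_all
  also have "(\<Prod>i<l. planted i) * \<dots> = (\<Prod>i\<le>p. planted i)"
    using assms by (subst prod.union_disjoint[symmetric]) (auto intro!: prod.cong)
  finally show ?thesis .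
qed

end

text \<open>
  The constant term of \<open>X\<^sub>0\<close> is \<open>t\<^sub>0\<close>, and its higher coefficients are those of \<open>Y\<close>; hence the factor
  \<open>t\<^sub>0\<close> on the left.
\<close>
lemma path_sum_closed_form:
  fixes t :: "nat \<Rightarrow> 'a::{idom,ring_char_0}"
  assumes "0 < p" "0 < k"
  shows "of_nat k * (t 0 * path_sum p t 0 (2 * p * k)) =
    (\<Sum>j | j \<in> {..p} \<rightarrow>\<^sub>E {..k} \<and> (\<Sum>l\<le>p. j l) = p * k + 1.
       \<Prod>l\<le>p. of_nat (k choose j l) * t l ^ j l)"
proof -
  let ?Y = "fps_X * (\<Prod>l\<le>p. planted p t l)"
  let ?\<phi> = "\<Prod>l\<le>p. fps_const (t l) + fps_X"
  have Y0: "?Y $ 0 = 0" by simp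
  have "(\<Prod>l\<le>p. planted p t l) = ?\<phi> oo ?Y"
    unfolding fps_compose_prod_distrib[OF Y0] using planted_eq[OF assms(1)] Y0
    by (intro prod.cong) (auto simp: fps_compose_add_distrib)
  then have "?Y = fps_X * (?\<phi> oo ?Y)" by simp
  from lagrange_inversion[OF this, of 1 k] assms
  have "of_nat k * ?Y $ k = (?\<phi> ^ k) $ (k - 1)" by simp
  also have "\<dots> = (\<Sum>j | j \<in> {..p} \<rightarrow>\<^sub>E {..k} \<and> (\<Sum>l\<le>p. j l) + (k - 1) = card {..p} * k.
       \<Prod>l\<le>p. of_nat (k choose j l) * t l ^ j l)"
    by (rule coeff_power_prod_linear) simp
  also have "(\<lambda>j. (\<Sum>l\<le>p. j l) + (k - 1) = card {..p} * k) = (\<lambda>j. (\<Sum>l\<le>p. j l) = p * k + 1)"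
    using assms(2) by (auto simp: fun_eq_iff)
  finally have "of_nat k * ?Y $ k = (\<Sum>j | j \<in> {..p} \<rightarrow>\<^sub>E {..k} \<and> (\<Sum>l\<le>p. j l) = p * k + 1.
       \<Prod>l\<le>p. of_nat (k choose j l) * t l ^ j l)" .
  moreover have "?Y $ k = t 0 * path_sum p t 0 (2 * p * k)"
  proof -
    have "planted p t 0 = fps_const (t 0) + ?Y"
      using planted_eq[OF assms(1), of 0] by simp
    then have "?Y $ k = (planted p t 0) $ k" using assms(2) by simp
    also have "planted p t 0 = fps_const (t 0) * up_fps p t 0"
      by (simp add: planted_def boundary_eqs(2))
    finally show ?thesis by (simp add: up_fps_def)
  qed
  ultimately show ?thesis by simp
qed

section \<open>Adapted pair partitions as arc diagrams\<close>
lemma zigzag_le: "zigzag p x \<le> p"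
  unfolding zigzag_def by linarith

lemma nth_concat_replicate:
  assumes "i < k * length w"
  shows "concat (replicate k w) ! i = w ! (i mod length w)"
  using assms
proof (induction k arbitrary: i)
  case (Suc k)
  then show ?case by (cases "i < length w") (simp_all add: nth_append le_mod_geq)
qed simp

lemma W0_nth:
  assumes "r < 2 * p"
  shows "W0 p ! r = (if r < p then Plain (Suc r) else Star (2 * p - r))"
proof (cases "r < p")
  case True
  then show ?thesis by (simp add: W0_def nth_append del: upt_Suc)
next
  case False
  with assms have "r - p < p" by simp
  with False assms show ?thesis
    by (simp add: W0_def nth_append rev_nth del: upt_Suc)
qed

lemma W0_power_nth:
  assumes "i < 2 * p * k"
  shows "W0_power k p ! i = W0 p ! (i mod (2 * p))"
proof -
  have "length (W0 p) = 2 * p" by (simp add: W0_def)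
  with nth_concat_replicate[of i k "W0 p"] assms show ?thesis
    by (simp add: W0_power_def mult.commute)
qed

lemma step_letter_cases:
  assumes "0 < y" "y \<le> 2 * p * k"
  obtains (up) l where "l < p" "letter_at (W0_power k p) y = Plain (Suc l)"
      "zigzag p (y - 1) = l" "zigzag p y = Suc l"
  | (down) l where "l < p" "letter_at (W0_power k p) y = Star (Suc l)"
      "zigzag p (y - 1) = Suc l" "zigzag p y = l"
proof -
  have "0 < p" using assms by (cases p) auto
  then show ?thesis using assms(1)
  proof (cases rule: step_cases)
    case (up m l)
    show ?thesis
    proof (rule that(1)[of l])
      show "letter_at (W0_power k p) y = Plain (Suc l)"
        using W0_power_nth[of "y - 1" p k] W0_nth[of l p] up assms by (simp add: letter_at_def)
      show "zigzag p (y - 1) = l" "zigzag p y = Suc l"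
        using zigzag_up[of l p m] zigzag_up[of "Suc l" p m] up by auto
    qed (rule up)
  next
    case (down m l)
    then obtain r where r: "l = Suc r" by (cases l) auto
    show ?thesis
    proof (rule that(2)[of r])
      have y1: "y - 1 = 2 * p * m + (2 * p - l)" and y: "y = 2 * p * m + (2 * p - r)"
        using down r by auto
      have "(y - 1) mod (2 * p) = 2 * p - l"
        unfolding y1 mod_mult_self4 using down by (intro mod_less) simp
      then show "letter_at (W0_power k p) y = Star (Suc r)"
        using W0_power_nth[of "y - 1" p k] W0_nth[of "2 * p - l" p] down r assms
        by (simp add: letter_at_def)
      show "zigzag p (y - 1) = Suc r" "zigzag p y = r"
        using zigzag_down[of l p m] zigzag_down[of r p m] down r y y1 by simp_all
      show "r < p" using down r by simp
    qed
  qed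
qed

lemma closes_iff_dual_letters:
  assumes "0 < a" "a \<le> 2 * p * k" "0 < b" "b \<le> 2 * p * k"
  shows "closes p a b \<longleftrightarrow>
    (\<exists>l\<in>{1..p}. {letter_at (W0_power k p) a, letter_at (W0_power k p) b} = {Plain l, Star l})"
  using assms(1,2)
proof (cases rule: step_letter_cases)
  case (up l)
  note a = up
  from assms(3,4) show ?thesis
    by (cases rule: step_letter_cases) (use a in \<open>auto simp: closes_def doubleton_eq_iff\<close>)
next
  case (down l)
  note a = down
  from assms(3,4) show ?thesis
    by (cases rule: step_letter_cases) (use a in \<open>auto simp: closes_def doubleton_eq_iff\<close>)
qed

definition blocks :: "(nat \<times> nat) set \<Rightarrow> nat set set" where
  "blocks E = (\<lambda>(x, y). {x, y}) ` E"

definition arcs :: "nat set set \<Rightarrow> (nat \<times> nat) set" where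
  "arcs \<pi> = {(x, y). x < y \<and> {x, y} \<in> \<pi>}"

lemma doubleton_in_blocks_iff:
  assumes "E \<in> arc_diagrams M a b"
  shows "{x, y} \<in> blocks E \<longleftrightarrow> (x, y) \<in> E \<or> (y, x) \<in> E"
  unfolding blocks_def by (auto simp: image_iff doubleton_eq_iff Bex_def)

lemma arcs_blocks:
  assumes "E \<in> arc_diagrams M a b"
  shows "arcs (blocks E) = E"
proof (intro equalityI subrelI)
  fix x y assume "(x, y) \<in> arcs (blocks E)"
  then have "x < y" "(x, y) \<in> E \<or> (y, x) \<in> E"
    by (simp_all add: arcs_def doubleton_in_blocks_iff[OF assms])
  with arc_diagramsD(1)[OF assms, of y x] show "(x, y) \<in> E" by auto
next
  fix x y assume "(x, y) \<in> E"
  with arc_diagramsD(1)[OF assms this] show "(x, y) \<in> arcs (blocks E)"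
    by (simp add: arcs_def doubleton_in_blocks_iff[OF assms])
qed

lemma blocks_arcs:
  assumes "\<And>B. B \<in> \<pi> \<Longrightarrow> card B = 2"
  shows "blocks (arcs \<pi>) = \<pi>"
proof (intro equalityI subsetI)
  fix B assume "B \<in> blocks (arcs \<pi>)"
  then show "B \<in> \<pi>" by (auto simp: blocks_def arcs_def)
next
  fix B assume B: "B \<in> \<pi>"
  with assms obtain x y where xy: "B = {x, y}" "x \<noteq> y" by (meson card_2_iff)
  show "B \<in> blocks (arcs \<pi>)"
  proof (cases "x < y")
    case True
    with B xy have "(x, y) \<in> arcs \<pi>" by (simp add: arcs_def)
    then show ?thesis unfolding blocks_def xy by (rule rev_image_eqI) simp
  next
    case False
    with B xy have "(y, x) \<in> arcs \<pi>" by (simp add: arcs_def insert_commute)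
    then show ?thesis unfolding blocks_def xy by (rule rev_image_eqI) auto
  qed
qed

lemma blocks_in_adapted_nc:
  assumes E: "E \<in> arc_diagrams (closes p) 0 (2 * p * k)"
  shows "blocks E \<in> adapted_nc k p"
proof -
  note range = arc_diagramsD(1)[OF E] and cover = arc_diagramsD(2)[OF E]
    and unique = arc_diagramsD(3)[OF E] and nc = arc_diagramsD(4)[OF E]
  note in_blocks = doubleton_in_blocks_iff[OF E]
  have ordered: "(x, y) \<in> E" if "{x, y} \<in> blocks E" "x < y" for x y
    using that range[of y x] in_blocks by auto
  have rep: "\<exists>x y. (x, y) \<in> E \<and> B = {x, y}" if "B \<in> blocks E" for B
    using that by (auto simp: blocks_def)
  have "partition_on {1..2 * p * k} (blocks E)"
  proof (rule partition_onI)
    show "\<Union> (blocks E) = {1..2 * p * k}"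
    proof (intro equalityI subsetI)
      fix z assume "z \<in> \<Union> (blocks E)"
      then obtain x y where "(x, y) \<in> E" "z = x \<or> z = y"
        using rep by blast
      with range[of x y] show "z \<in> {1..2 * p * k}" by auto
    next
      fix z assume "z \<in> {1..2 * p * k}"
      then obtain x y where xy: "(x, y) \<in> E" "z = x \<or> z = y"
        using cover[of z] by auto
      then have "{x, y} \<in> blocks E" by (simp add: in_blocks)
      with xy(2) show "z \<in> \<Union> (blocks E)" by blast
    qed
    show "disjnt B C" if BC: "B \<in> blocks E" "C \<in> blocks E" "B \<noteq> C" for B C
    proof -
      obtain x y where B: "(x, y) \<in> E" "B = {x, y}"
        using rep[OF BC(1)] by blast
      obtain u v where C: "(u, v) \<in> E" "C = {u, v}"
        using rep[OF BC(2)] by blast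
      have "{x, y} \<inter> {u, v} = {}"
        using unique[OF B(1) C(1)] BC(3) B(2) C(2) by blast
      with B C show ?thesis by (simp add: disjnt_def)
    qed
    show "{} \<notin> blocks E"
      using rep by blast
  qed
  moreover have "card B = 2" if B: "B \<in> blocks E" for B
  proof -
    obtain x y where "(x, y) \<in> E" "B = {x, y}" using rep[OF B] by blast
    with range[of x y] show ?thesis by simp
  qed
  moreover have "\<not> (\<exists>a b c e. {a, b} \<in> blocks E \<and> {c, e} \<in> blocks E \<and> a < c \<and> c < b \<and> b < e)"
  proof clarify
    fix a b c e assume *: "{a, b} \<in> blocks E" "{c, e} \<in> blocks E" "a < c" "c < b" "b < e"
    then have "(a, b) \<in> E" "(c, e) \<in> E" by (auto intro: ordered)
    with nc * show False by blast
  qed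
  moreover have "\<exists>l\<in>{1..p}. {letter_at (W0_power k p) a, letter_at (W0_power k p) b} = {Plain l, Star l}"
    if "{a, b} \<in> blocks E" for a b
  proof -
    have *: "\<exists>l\<in>{1..p}. {letter_at (W0_power k p) x, letter_at (W0_power k p) y} = {Plain l, Star l}"
      if "(x, y) \<in> E" for x y
      using range[OF that] closes_iff_dual_letters[of x p k y] by auto
    from that consider "(a, b) \<in> E" | "(b, a) \<in> E" by (auto simp: in_blocks)
    then show ?thesis
    proof cases
      case 1
      then show ?thesis by (rule *)
    next
      case 2
      from *[OF this] show ?thesis by (simp only: insert_commute)
    qed
  qed
  ultimately show ?thesis
    unfolding adapted_nc_def nc_pair_partitions_def by blast
qed

lemma arcs_in_arc_diagrams:
  assumes "\<pi> \<in> adapted_nc k p"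
  shows "arcs \<pi> \<in> arc_diagrams (closes p) 0 (2 * p * k)"
proof -
  have part: "partition_on {1..2 * p * k} \<pi>" and card: "\<And>B. B \<in> \<pi> \<Longrightarrow> card B = 2"
    and nc: "\<And>a b c e. {a, b} \<in> \<pi> \<Longrightarrow> {c, e} \<in> \<pi> \<Longrightarrow> a < c \<Longrightarrow> c < b \<Longrightarrow> b < e \<Longrightarrow> False"
    and letters: "\<And>a b. {a, b} \<in> \<pi> \<Longrightarrow>
      \<exists>l\<in>{1..p}. {letter_at (W0_power k p) a, letter_at (W0_power k p) b} = {Plain l, Star l}"
    using assms unfolding adapted_nc_def nc_pair_partitions_def by blast+
  have in_range: "x \<in> {1..2 * p * k}" if "B \<in> \<pi>" "x \<in> B" for x B
    using partition_onD1[OF part] that by blast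
  have arc: "x < y" "{x, y} \<in> \<pi>" if "(x, y) \<in> arcs \<pi>" for x y
    using that by (auto simp: arcs_def)
  show ?thesis
  proof (rule arc_diagramsI)
    fix x y assume xy: "(x, y) \<in> arcs \<pi>"
    have "x \<in> {1..2 * p * k}" "y \<in> {1..2 * p * k}"
      using in_range[OF arc(2)[OF xy]] by auto
    then show "0 < x \<and> x < y \<and> y \<le> 2 * p * k \<and> closes p x y"
      using arc[OF xy] letters closes_iff_dual_letters[of x p k y] by auto
  next
    fix z assume "0 < z" "z \<le> 2 * p * k"
    then have "z \<in> \<Union>\<pi>"
      unfolding partition_onD1[OF part, symmetric] by simp
    then obtain B where B: "B \<in> \<pi>" "z \<in> B" by blast
    have "B \<in> blocks (arcs \<pi>)"
      using B(1) card by (simp add: blocks_arcs)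
    then obtain e where "e \<in> arcs \<pi>" "B = (\<lambda>(x, y). {x, y}) e"
      unfolding blocks_def by (rule imageE)
    with B(2) show "\<exists>x y. (x, y) \<in> arcs \<pi> \<and> (z = x \<or> z = y)"
      by (cases e) auto
  next
    fix x y u v assume *: "(x, y) \<in> arcs \<pi>" "(u, v) \<in> arcs \<pi>" "{x, y} \<inter> {u, v} \<noteq> {}"
    have "{x, y} = {u, v}"
      using disjointD[OF partition_onD2[OF part] arc(2)[OF *(1)] arc(2)[OF *(2)]] *(3) by blast
    with arc(1)[OF *(1)] arc(1)[OF *(2)] show "x = u \<and> y = v"
      by (auto simp: doubleton_eq_iff)
  next
    fix x y u v assume "(x, y) \<in> arcs \<pi>" "(u, v) \<in> arcs \<pi>" "x < u" "u < y" "y < v"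
    then show False using arc(2) nc by blast
  qed
qed

lemma bij_betw_blocks:
  "bij_betw blocks (arc_diagrams (closes p) 0 (2 * p * k)) (adapted_nc k p)"
proof (rule bij_betw_byWitness[where f' = arcs])
  show "\<forall>\<pi>\<in>adapted_nc k p. blocks (arcs \<pi>) = \<pi>"
    by (auto intro!: blocks_arcs simp: adapted_nc_def nc_pair_partitions_def)
qed (use arcs_blocks blocks_in_adapted_nc arcs_in_arc_diagrams in auto)

text \<open>The two letters that are read by a step from height \<open>l\<close> are \<open>l + 1\<close> and \<open>l\<^sup>*\<close>.\<close>
lemma leg_count_blocks:
  assumes E: "E \<in> arc_diagrams (closes p) 0 (2 * p * k)"
  shows "leg_count k p l (blocks E) = card {e \<in> E. zigzag p (snd e - 1) = l}"
proof -
  note range = arc_diagramsD(1)[OF E] and unique = arc_diagramsD(3)[OF E]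
  let ?R = "\<lambda>P. {e \<in> E. P (letter_at (W0_power k p) (snd e))}"
  have legs: "right_legs (blocks E) = snd ` E"
    using range by (force simp: right_legs_def doubleton_in_blocks_iff[OF E] image_iff)
  have inj: "inj_on snd E"
  proof (rule inj_onI)
    fix e e' assume *: "e \<in> E" "e' \<in> E" "snd e = snd e'"
    have "(fst e, snd e) \<in> E" "(fst e', snd e') \<in> E"
      using *(1,2) by simp_all
    moreover have "snd e \<in> {fst e, snd e} \<inter> {fst e', snd e'}"
      using *(3) by simp
    ultimately have "fst e = fst e' \<and> snd e = snd e'" by (intro unique) auto
    then show "e = e'" by (simp add: prod_eq_iff)
  qed
  have card: "card {b \<in> right_legs (blocks E). P (letter_at (W0_power k p) b)} = card (?R P)" for P
  proof -
    have "{b \<in> right_legs (blocks E). P (letter_at (W0_power k p) b)} = snd ` ?R P"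
      unfolding legs by auto
    then show ?thesis using inj by (simp add: card_image inj_on_subset)
  qed
  have step: "zigzag p (snd e - 1) = l \<longleftrightarrow>
      letter_at (W0_power k p) (snd e) = Plain (l + 1) \<or> letter_at (W0_power k p) (snd e) = Star l"
    if "e \<in> E" for e
  proof -
    have "0 < snd e" "snd e \<le> 2 * p * k"
      using range[of "fst e" "snd e"] that by auto
    then show ?thesis by (cases rule: step_letter_cases) auto
  qed
  have "leg_count k p l (blocks E) = card (?R (\<lambda>c. c = Plain (l + 1))) + card (?R (\<lambda>c. c = Star l))"
    unfolding leg_count_def R_plain_def R_star_def
    using card[of "\<lambda>c. c = Plain (l + 1)"] card[of "\<lambda>c. c = Star l"] by simp
  also have "\<dots> = card (?R (\<lambda>c. c = Plain (l + 1)) \<union> ?R (\<lambda>c. c = Star l))"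
    using finite_arc_diagram[OF E] by (intro card_Un_disjoint[symmetric]) auto
  also have "?R (\<lambda>c. c = Plain (l + 1)) \<union> ?R (\<lambda>c. c = Star l) = {e \<in> E. zigzag p (snd e - 1) = l}"
    using step by blast
  finally show ?thesis .
qed

lemma P_poly_eq_path_sum: "P_poly k p d = path_sum p d 0 (2 * p * k)"
proof -
  have weight: "(\<Prod>l=0..p. d l ^ leg_count k p l (blocks E)) = (\<Prod>e\<in>E. d (zigzag p (snd e - 1)))"
    if E: "E \<in> arc_diagrams (closes p) 0 (2 * p * k)" for E
  proof -
    have "(\<Prod>l=0..p. d l ^ leg_count k p l (blocks E))
        = (\<Prod>l=0..p. \<Prod>e | e \<in> E \<and> zigzag p (snd e - 1) = l. d (zigzag p (snd e - 1)))"
      by (intro prod.cong refl) (simp add: leg_count_blocks[OF E])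
    also have "\<dots> = (\<Prod>e\<in>E. d (zigzag p (snd e - 1)))"
      by (rule prod.group) (use finite_arc_diagram[OF E] zigzag_le in auto)
    finally show ?thesis .
  qed
  have "P_poly k p d = (\<Sum>E\<in>arc_diagrams (closes p) 0 (2 * p * k). \<Prod>l=0..p. d l ^ leg_count k p l (blocks E))"
    unfolding P_poly_def by (rule sum.reindex_bij_betw[OF bij_betw_blocks, symmetric])
  also have "\<dots> = path_sum p d 0 (2 * p * k)"
    unfolding path_sum_def arc_sum_def by (rule sum.cong) (simp_all add: weight)
  finally show ?thesis .
qed

section \<open>Comparison with the Fuss-Narayana polynomials\<close>
lemma Const_mult: "Const a * Const b = Const (a * b)"
  by (simp add: Const_def mult_single)

lemma Const_of_nat: "Const (of_nat n) = of_nat n"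
  unfolding Const_def by (subst of_nat_single) (rule o_apply[symmetric])

lemma exponents_positive:
  fixes j :: "nat \<Rightarrow> nat"
  assumes "j \<in> {..p} \<rightarrow>\<^sub>E {..k}" "(\<Sum>l\<le>p. j l) = p * k + 1" "l \<le> p"
  shows "0 < j l"
proof (rule ccontr)
  assume "\<not> 0 < j l"
  then have "(\<Sum>l\<le>p. j l) = (\<Sum>i\<in>{..p} - {l}. j i)"
    using assms(3) sum.remove[OF finite_atMost, of l p j] by simp
  also have "\<dots> \<le> (\<Sum>i\<in>{..p} - {l}. k)"
    using assms(1) by (intro sum_mono) (auto simp: PiE_iff)
  also have "\<dots> = p * k" using assms(3) by simp
  finally show False using assms(2) by simp
qed

text \<open>Multiplying by \<open>k\<close> clears the denominators, and \<open>t\<^sub>0 = 1\<close> makes the summands symmetric in \<open>0, \<dots>, p\<close>.\<close>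
lemma fuss_narayana_closed_form:
  assumes "0 < k" "t = (\<lambda>l. if l = 0 then 1 else Var l)"
  shows "of_nat k * fuss_narayana k p =
    (\<Sum>j | j \<in> {..p} \<rightarrow>\<^sub>E {..k} \<and> (\<Sum>l\<le>p. j l) = p * k + 1.
       \<Prod>l\<le>p. of_nat (k choose j l) * t l ^ j l)"
proof -
  have set_eq: "{j \<in> {0..p} \<rightarrow>\<^sub>E {1..k}. (\<Sum>l=0..p. j l) = p * k + 1}
      = {j. j \<in> {..p} \<rightarrow>\<^sub>E {..k} \<and> (\<Sum>l\<le>p. j l) = p * k + 1}"
    (is "?L = ?R")
  proof (intro equalityI subsetI)
    fix j assume "j \<in> ?L"
    then show "j \<in> ?R" by (simp add: PiE_iff atLeast0AtMost)
  next
    fix j assume j: "j \<in> ?R"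
    have "1 \<le> j l" if "l \<le> p" for l
      using exponents_positive[of j p k l] j that by simp
    with j show "j \<in> ?L" by (simp add: PiE_iff atLeast0AtMost)
  qed
  have "of_nat k * (Const (1 / of_nat k * (\<Prod>l=0..p. of_nat (k choose j l))) * (\<Prod>l=1..p. Var l ^ j l))
      = (\<Prod>l\<le>p. of_nat (k choose j l) * t l ^ j l)" for j
  proof -
    have "of_nat k * (1 / of_nat k * (\<Prod>l=0..p. of_nat (k choose j l))) = (of_nat (\<Prod>l=0..p. k choose j l) :: rat)"
      using assms(1) by simp
    then have "of_nat k * Const (1 / of_nat k * (\<Prod>l=0..p. of_nat (k choose j l)))
        = (of_nat (\<Prod>l=0..p. k choose j l) :: rat_mpoly)"
      unfolding Const_of_nat[of k, symmetric] Const_mult by (simp only: Const_of_nat)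
    moreover have "(\<Prod>l=1..p. Var l ^ j l) = (\<Prod>l\<le>p. t l ^ j l)"
      unfolding assms(2) atMost_atLeast0
      by (subst (2) prod.atLeast_Suc_atMost) (auto intro!: prod.cong)
    ultimately show ?thesis
      unfolding mult.assoc[symmetric] prod.distrib by (simp only: of_nat_prod atMost_atLeast0)
  qed
  then show ?thesis
    unfolding fuss_narayana_def sum_distrib_left set_eq by (rule sum.cong[OF refl])
qed

theorem corollary4p1:
  fixes k p :: nat
  assumes "k \<ge> 1" and "p \<ge> 1"
  shows "fuss_narayana k p = P_poly k p (\<lambda>l. if l = 0 then 1 else Var l)"
proof -
  define t :: "nat \<Rightarrow> rat_mpoly" where "t = (\<lambda>l. if l = 0 then 1 else Var l)"
  have pos: "0 < k" "0 < p" using assms by auto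
  have "of_nat k * fuss_narayana k p = of_nat k * (t 0 * path_sum p t 0 (2 * p * k))"
    unfolding fuss_narayana_closed_form[OF pos(1) t_def] path_sum_closed_form[OF pos(2,1)] ..
  then have "fuss_narayana k p = t 0 * path_sum p t 0 (2 * p * k)"
    using pos(1) by simp
  also have "t 0 = 1" by (simp add: t_def)
  finally show ?thesis
    unfolding P_poly_eq_path_sum t_def[symmetric] by simp
qed

end
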